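(* Let $n\ge 1$ be an integer, let $m,d,k_1,k_3>0$, and let $\boldsymbol L\in\mathbb{R}^{n\times n}$ be the (symmetric) Laplacian matrix of a connected undirected weighted graph on $n$ nodes with positive edge weights, with eigenvalues $\lambda_1=0,\lambda_2,\dots,\lambda_n$ (listed with multiplicity, $\lambda_1=0$ having eigenvector $\boldsymbol 1_n$). Consider the closed-loop system of DPIAC with input matrix $\boldsymbol B=\boldsymbol I_n$, \begin{align*} \dot{\boldsymbol\theta}&=\boldsymbol\omega,\\ m\,\dot{\boldsymbol\omega}&=-\boldsymbol L\boldsymbol\theta-d\,\boldsymbol\omega+4k_1\boldsymbol\xi+\boldsymbol w,\\ \dot{\boldsymbol\eta}&=d\,\boldsymbol\omega+4k_1k_3\boldsymbol L\boldsymbol\xi,\\ \dot{\boldsymbol\xi}&=-k_1m\,\boldsymbol\omega-k_1\boldsymbol\eta-4k_1\boldsymbol\xi, \end{align*} with state $(\boldsymbol\theta,\boldsymbol\omega,\boldsymbol\eta,\boldsymbol\xi)\in(\mathbb{R}^n)^4$, input $\boldsymbol w\in\mathbb{R}^n$, and control input $\boldsymbol u=4k_1\boldsymbol\xi$. Let $\|\boldsymbol G_d(\boldsymbol\omega,\boldsymbol w)\|_2^2$, $\|\boldsymbol G_d(\boldsymbol u,\boldsymbol w)\|_2^2$ and $\|\boldsymbol G_d(4k_1\boldsymbol L\boldsymbol\xi,\boldsymbol w)\|_2^2$ be the squared $\mathcal{H}_2$ norms of this system from the input $\boldsymbol w$ to the outputs $\boldsymbol y=\boldsymbol\omega$, $\boldsymbol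 y=\boldsymbol u$ and $\boldsymbol y=4k_1\boldsymbol L\boldsymbol\xi$, respectively. Then \begin{align*} \|\boldsymbol G_d(\boldsymbol\omega,\boldsymbol w)\|_2^2&=\frac{1}{2m}\sum_{i=2}^n\frac{b_{1i}}{e_i}+\frac{d+5mk_1}{2m(2k_1m+d)^2},\\ \|\boldsymbol G_d(\boldsymbol u,\boldsymbol w)\|_2^2&=\frac{k_1}{2}+\sum_{i=2}^n\frac{b_{2i}}{e_i},\\ \|\boldsymbol G_d(4k_1\boldsymbol L\boldsymbol\xi,\boldsymbol w)\|_2^2&=\sum_{i=2}^n\frac{\lambda_i^2b_{2i}}{e_i}, \end{align*} where, for $i=2,\dots,n$, \begin{align*} b_{1i}&=\lambda_i^2(4k_1^2k_3m-1)^2+4dmk_1^3+k_1(d+4k_1m)(4d\lambda_ik_1k_3+5\lambda_i+4dk_1),\\ b_{2i}&=2dk_1^3(d+2k_1m)^2+2\lambda_ik_1^4m^2(4k_1k_3d+4),\\ e_i&=d\lambda_i^2(4k_1^2k_3m-1)^2+16d\lambda_ik_1^4k_3m^2+d^2\lambda_ik_1+4k_1(d+2k_1m)^2(dk_1+\lambda_i+d\lambda_ik_1k_3). \end{align*}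
   Context: $\boldsymbol 1_n\in\mathbb{R}^n$ is the all-ones vector and $\boldsymbol I_n$ the identity matrix. DPIAC (Distributed Power-Imbalance Allocation Control) is a distributed secondary frequency control law for power systems; the system in the claim is the linearized power system with homogeneous parameters (inertia $m$, damping $d$, control prices $1$), with communication network equal to the power network (both with Laplacian $\boldsymbol L$), closed by this law with gains $k_1$, $k_2=4k_1$ and $k_3$. Here $\boldsymbol\theta$ are phase angles, $\boldsymbol\omega$ frequency deviations, and $\boldsymbol\eta,\boldsymbol\xi$ controller states. The output $4k_1\boldsymbol L\boldsymbol\xi$ measures the differences of the marginal costs. $\mathcal{H}_2$ norm: for a linear time-invariant system $\dot{\boldsymbol x}=\boldsymbol A\boldsymbol x+\tilde{\boldsymbol B}\boldsymbol w$, $\boldsymbol y=\boldsymbol C\boldsymbol x$, the squared $\mathcal{H}_2$ norm of the transfer matrix from $\boldsymbol w$ to $\boldsymbol y$ is $$\int_0^\infty \mathrm{tr}\big(\tilde{\boldsymbol B}^Te^{\boldsymbol A^Tt}\boldsymbol C^T\boldsymbol C e^{\boldsymbol At}\tilde{\boldsymbol B}\big)\,dt .$$ When $\boldsymbol A$ is Hurwitz this equals $\mathrm{tr}(\tilde{\boldsymbol B}^T\boldsymbol Q_o\tilde{\boldsymbol B})$, where $\boldsymbol Q_o$ solves $\boldsymbol Q_o\boldsymbol A+\boldsymbol A^T\boldsymbol Q_o+\boldsymbol C^T\boldsymbol C=\boldsymbol 0$. The system is put in this form by taking $\boldsymbol x=(\boldsymbol\theta,\boldsymbol\omega,\boldsymbol\eta,\boldsymbol\xi)$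 and dividing the second equation by $m$. *)

theory Defs
  imports "HOL-Analysis.Analysis"
begin

section \<open>Weighted graphs and their Laplacians\<close>

text \<open>
  The vertex set is the whole finite type \<open>'n\<close>, so the number of nodes is \<open>CARD('n) \<ge> 1\<close>.
  An undirected edge is represented by both of its orientations in \<open>E\<close>; the values of \<open>w\<close>
  off \<open>E\<close> are irrelevant.
\<close>

definition connected_weighted_graph :: "('n::finite \<times> 'n) set \<Rightarrow> ('n \<Rightarrow> 'n \<Rightarrow> real) \<Rightarrow> bool" where
  "connected_weighted_graph E w \<longleftrightarrow>
     sym E \<and> irrefl E \<and> (\<forall>i j. (i, j) \<in> E\<^sup>*) \<and>
     (\<forall>(i, j)\<in>E. w i j = w j i \<and> w i j > 0)"

definition laplacian :: "('n::finite \<times> 'n) set \<Rightarrow> ('n \<Rightarrow> 'n \<Rightarrow> real) \<Rightarrow> real^'n^'n" where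
  "laplacian E w = (\<chi> i j. if i = j then (\<Sum>k\<in>E `` {i}. w i k)
                           else if (i, j) \<in> E then - w i j else 0)"

text \<open>\<open>lam 1, \<dots>, lam n\<close> is a list of all eigenvalues of the matrix, with (algebraic) multiplicity:
  the characteristic polynomial of \<open>M\<close> splits accordingly.\<close>

definition eigenvalues_with_mult :: "real^'n^'n \<Rightarrow> (nat \<Rightarrow> real) \<Rightarrow> bool" where
  "eigenvalues_with_mult M lam \<longleftrightarrow>
     (\<forall>x. det (mat x - M) = (\<Prod>i=1..CARD('n). (x - lam i)))"

section \<open>The squared H2 norm of a linear time-invariant system\<close>

definition mexp :: "real^'n^'n \<Rightarrow> real^'n^'n" where
  "mexp A = (\<Sum>k. (1 / fact k) *\<^sub>R (((**) A ^^ k) (mat 1)))"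

text \<open>\<open>has_squared_h2_norm A B C v\<close>: the improper integral defining the squared H2 norm of
  \<open>x' = A x + B w\<close>, \<open>y = C x\<close> converges, with value \<open>v\<close> (which is then unique). A relation is used
  so that a divergent integral cannot be confused with the value \<open>0\<close>.\<close>

definition has_squared_h2_norm ::
    "real^'s^'s \<Rightarrow> real^'p^'s \<Rightarrow> real^'s^'q \<Rightarrow> real \<Rightarrow> bool" where
  "has_squared_h2_norm A B C v \<longleftrightarrow>
     ((\<lambda>t. trace (transpose B ** mexp (t *\<^sub>R transpose A) ** transpose C
                  ** C ** mexp (t *\<^sub>R A) ** B)) has_integral v) {0..}"

section \<open>The closed-loop system of DPIAC\<close>

text \<open>The state \<open>(\<theta>, \<omega>, \<eta>, \<xi>)\<close> is a single vector indexed by pairs of a block name and a node.\<close>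

datatype dpiac_block = Theta | Omega | Eta | Xi

instance dpiac_block :: finite
proof
  have "(UNIV :: dpiac_block set) = {Theta, Omega, Eta, Xi}"
    using dpiac_block.exhaust by auto
  then show "finite (UNIV :: dpiac_block set)"
    by (metis finite.emptyI finite_insert)
qed

definition dpiac_state ::
    "real^'n \<Rightarrow> real^'n \<Rightarrow> real^'n \<Rightarrow> real^'n \<Rightarrow> real^(dpiac_block \<times> 'n)" where
  "dpiac_state \<theta> \<omega> \<eta> \<xi> =
     (\<chi> p. (case fst p of Theta \<Rightarrow> \<theta> | Omega \<Rightarrow> \<omega> | Eta \<Rightarrow> \<eta> | Xi \<Rightarrow> \<xi>) $ snd p)"

text \<open>Blocks of the system matrix, the second equation being divided by \<open>m\<close>. The gain \<open>k\<^sub>2 = 4 k\<^sub>1\<close>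
  is already substituted.\<close>

fun dpiac_entry ::
    "real \<Rightarrow> real \<Rightarrow> real \<Rightarrow> real \<Rightarrow> real^'n^'n \<Rightarrow> dpiac_block \<Rightarrow> dpiac_block \<Rightarrow> real^'n^'n" where
  "dpiac_entry m d k1 k3 L Theta Omega = mat 1"
| "dpiac_entry m d k1 k3 L Omega Theta = (- 1 / m) *\<^sub>R L"
| "dpiac_entry m d k1 k3 L Omega Omega = mat (- d / m)"
| "dpiac_entry m d k1 k3 L Omega Xi = mat (4 * k1 / m)"
| "dpiac_entry m d k1 k3 L Eta Omega = mat d"
| "dpiac_entry m d k1 k3 L Eta Xi = (4 * k1 * k3) *\<^sub>R L"
| "dpiac_entry m d k1 k3 L Xi Omega = mat (- k1 * m)"
| "dpiac_entry m d k1 k3 L Xi Eta = mat (- k1)"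
| "dpiac_entry m d k1 k3 L Xi Xi = mat (- 4 * k1)"
| "dpiac_entry m d k1 k3 L _ _ = 0"

definition dpiac_A ::
    "real \<Rightarrow> real \<Rightarrow> real \<Rightarrow> real \<Rightarrow> real^'n^'n \<Rightarrow> real^(dpiac_block \<times> 'n)^(dpiac_block \<times> 'n)" where
  "dpiac_A m d k1 k3 L =
     (\<chi> p q. dpiac_entry m d k1 k3 L (fst p) (fst q) $ snd p $ snd q)"

text \<open>The input enters the second equation only, through \<open>B w\<close>, and is divided by \<open>m\<close> as well.\<close>

definition dpiac_input :: "real \<Rightarrow> real^'n^'n \<Rightarrow> real^'n^(dpiac_block \<times> 'n)" where
  "dpiac_input m B = (\<chi> p j. if fst p = Omega then (1 / m) * B $ snd p $ j else 0)"

text \<open>The output \<open>y = M z\<close>, where \<open>z\<close> is the block \<open>b\<close> of the state.\<close>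

definition dpiac_output :: "dpiac_block \<Rightarrow> real^'n^'n \<Rightarrow> real^(dpiac_block \<times> 'n)^'n" where
  "dpiac_output b M = (\<chi> i q. if fst q = b then M $ i $ snd q else 0)"

text \<open>Sanity checks: in terms of the four blocks, the right-hand side of the state equation and
  the outputs are the expected ones.\<close>

lemma UNIV_dpiac_block: "(UNIV :: dpiac_block set) = {Theta, Omega, Eta, Xi}"
  using dpiac_block.exhaust by auto

lemma sum_dpiac_index:
  "(\<Sum>p\<in>UNIV. f p) = (\<Sum>j\<in>UNIV. f (Theta, j)) + (\<Sum>j\<in>UNIV. f (Omega, j))
      + (\<Sum>j\<in>UNIV. f (Eta, j)) + (\<Sum>j\<in>UNIV. (f (Xi, j) :: real))"
proof -
  have "(\<Sum>p\<in>UNIV. f p) = (\<Sum>b\<in>UNIV. \<Sum>j\<in>UNIV. f (b, j))"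
    by (simp add: sum.cartesian_product)
  then show ?thesis
    by (simp add: UNIV_dpiac_block)
qed

lemma sum_mat_mult: "(\<Sum>j\<in>UNIV. mat c $ i $ j * v $ j) = c * (v :: real^'n) $ i"
  by (simp add: mat_def if_distrib[where f = "\<lambda>x. x * _"] cong: if_cong)

lemma dpiac_state_equation:
  fixes L B :: "real^'n^'n"
  shows "dpiac_A m d k1 k3 L *v dpiac_state \<theta> \<omega> \<eta> \<xi> + dpiac_input m B *v w =
    dpiac_state
      \<omega>
      ((1 / m) *\<^sub>R (- (L *v \<theta>) - d *\<^sub>R \<omega> + (4 * k1) *\<^sub>R \<xi> + B *v w))
      (d *\<^sub>R \<omega> + (4 * k1 * k3) *\<^sub>R (L *v \<xi>))
      (- (k1 * m) *\<^sub>R \<omega> - k1 *\<^sub>R \<eta> - (4 * k1) *\<^sub>R \<xi>)"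
    (is "?l = ?r")
proof -
  have "?l $ (b, i) = ?r $ (b, i)" for b i
    by (cases b)
      (simp_all add: dpiac_A_def dpiac_input_def dpiac_state_def matrix_vector_mult_def
        sum_dpiac_index sum_mat_mult mult.assoc flip: sum_distrib_left sum_divide_distrib,
       simp_all add: algebra_simps diff_divide_distrib add_divide_distrib
         sum_negf flip: sum_distrib_left sum_divide_distrib)
  then show ?thesis
    by (auto simp: vec_eq_iff)
qed

lemma dpiac_output_equation:
  fixes M :: "real^'n^'n"
  shows "dpiac_output b M *v dpiac_state \<theta> \<omega> \<eta> \<xi> =
    M *v (case b of Theta \<Rightarrow> \<theta> | Omega \<Rightarrow> \<omega> | Eta \<Rightarrow> \<eta> | Xi \<Rightarrow> \<xi>)"
  by (cases b)
    (simp_all add: dpiac_output_def dpiac_state_def matrix_vector_mult_def vec_eq_iff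
      sum_dpiac_index)

end

theory Submission
  imports Defs
begin

text \<open>
  Projecting the states excited by unit impulses onto an orthonormal eigenbasis of the Laplacian
  decouples the system into one four-dimensional system per eigenvalue \<open>\<lambda> \<ge> 0\<close>, whose phase
  \<open>\<theta>\<close> solves a scalar differential equation of order four. Multiplying that equation by
  \<open>\<theta>\<close> and its first three derivatives and integrating by parts yields linear equations for the
  integrals of the squares of these derivatives. Their determinant, \<open>4 k\<^sub>1 e / m\<^sup>3\<close> up to sign, is
  the third Hurwitz determinant. A combination of the same identities is a Lyapunov function
  and gives the decay at infinity. The eigenvalue \<open>0\<close> is not exceptional: the same formulas at
  \<open>\<lambda> = 0\<close> give the constant terms of the theorem.
\<close>

section \<open>Decay and energy integrals\<close>

text \<open>A form of Barbalat's lemma: convergence of \<open>f\<close> forces a point of small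
  slope in every short late window, and the bound on \<open>h\<close> keeps \<open>g\<close> from
  changing much within that window.\<close>

lemma derivative_tendsto_zero:
  fixes f g h :: "real \<Rightarrow> real"
  assumes f: "\<And>t. (f has_real_derivative g t) (at t)"
    and g: "\<And>t. (g has_real_derivative h t) (at t)"
    and h: "\<And>t. t \<ge> 0 \<Longrightarrow> \<bar>h t\<bar> \<le> K"
    and lim: "(f \<longlongrightarrow> l) at_top"
  shows "(g \<longlongrightarrow> 0) at_top"
proof (rule tendstoI)
  fix \<epsilon> :: real assume "\<epsilon> > 0"
  have "K \<ge> 0" using h[of 0] by linarith
  \<comment> \<open>Over a window of this length \<open>g\<close> varies by at most \<epsilon>/2;
    \<open>K + 1\<close> keeps the denominator positive when \<open>K = 0\<close>.\<close>
  define \<delta> where "\<delta> = \<epsilon> / (2 * (K + 1))"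
  have "\<delta> > 0" and K\<delta>: "K * \<delta> \<le> \<epsilon> / 2"
    using \<open>\<epsilon> > 0\<close> \<open>K \<ge> 0\<close> by (auto simp: \<delta>_def field_simps)
  have "((\<lambda>t. f (t + \<delta>)) \<longlongrightarrow> l) at_top"
    by (rule filterlim_compose[OF lim]) (auto simp: filterlim_at_top eventually_at_top_linorder
        intro: exI[of _ "x - \<delta>" for x], metis diff_le_eq)
  then have "((\<lambda>t. f (t + \<delta>) - f t) \<longlongrightarrow> 0) at_top"
    using tendsto_diff[OF _ lim] by fastforce
  then have "\<forall>\<^sub>F t in at_top. \<bar>f (t + \<delta>) - f t\<bar> < \<delta> * \<epsilon> / 2"
    using \<open>\<epsilon> > 0\<close> \<open>\<delta> > 0\<close>
    by (simp add: tendsto_iff dist_real_def del: less_divide_eq_numeral1)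
  then show "\<forall>\<^sub>F t in at_top. dist (g t) 0 < \<epsilon>"
    using eventually_ge_at_top[of 0]
  proof eventually_elim
    case (elim t)
    obtain z where z: "t < z" "z < t + \<delta>" "f (t + \<delta>) - f t = \<delta> * g z"
      using MVT2[of t "t + \<delta>" f g] f \<open>\<delta> > 0\<close> by auto
    obtain y where y: "t < y" "y < z" "g z - g t = (z - t) * h y"
      using MVT2[of t z g h] g z(1) by auto
    have "\<bar>(z - t) * h y\<bar> \<le> \<delta> * K"
      unfolding abs_mult using z y elim h[of y] \<open>\<delta> > 0\<close> by (intro mult_mono) auto
    then have "\<bar>g z - g t\<bar> \<le> \<epsilon> / 2" using y K\<delta> by (simp add: mult.commute)
    moreover have "\<bar>g z\<bar> < \<epsilon> / 2"
    proof -
      have "\<delta> * \<bar>g z\<bar> < \<delta> * (\<epsilon> / 2)" using elim z(3) \<open>\<delta> > 0\<close> by (simp add: abs_mult)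
      then show ?thesis using \<open>\<delta> > 0\<close> mult_less_cancel_left_pos by blast
    qed
    ultimately show ?case unfolding dist_real_def by linarith
  qed
qed

lemma antimono_tendsto_at_top:
  fixes f :: "real \<Rightarrow> real"
  assumes "antimono f" and "\<And>t. f t \<ge> 0"
  shows "\<exists>l. (f \<longlongrightarrow> l) at_top"
proof -
  have bdd: "bdd_below (range f)" using assms(2) by (intro bdd_belowI2) auto
  have "(f \<longlongrightarrow> (INF t. f t)) at_top"
  proof (rule decreasing_tendsto)
    show "\<forall>\<^sub>F t in at_top. (INF t. f t) \<le> f t"
      using bdd by (intro always_eventually allI cINF_lower) auto
  next
    fix x assume "(INF t. f t) < x"
    then obtain s where "f s < x" using bdd by (subst (asm) cINF_less_iff) auto
    then have "f t < x" if "t \<ge> s" for t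
      using antimonoD[OF assms(1) that] by linarith
    then show "\<forall>\<^sub>F t in at_top. f t < x"
      by (auto simp: eventually_at_top_linorder)
  qed
  then show ?thesis by blast
qed

lemma has_integral_antiderivative_to_inf:
  fixes F f :: "real \<Rightarrow> real"
  assumes F: "\<And>t. (F has_real_derivative f t) (at t)" and "\<And>t. f t \<ge> 0"
    and lim: "(F \<longlongrightarrow> 0) at_top"
  shows "(f has_integral - F 0) {0..}"
proof (rule has_integral_to_inf)
  have FTC: "(f has_integral F y - F 0) {0..y}" if "y \<ge> 0" for y
    using F that
    by (intro fundamental_theorem_of_calculus)
      (auto simp flip: has_real_derivative_iff_has_vector_derivative intro: DERIV_subset)
  show "f integrable_on {0..y}" for y
    using FTC[of y] by (cases "y \<ge> 0") (auto simp: integrable_on_def)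
  have "\<forall>\<^sub>F y in at_top. F y - F 0 = integral {0..y} f"
    using eventually_ge_at_top[of 0] by eventually_elim (metis FTC integral_unique)
  moreover have "((\<lambda>y. F y - F 0) \<longlongrightarrow> - F 0) at_top"
    using tendsto_diff[OF lim tendsto_const[of "F 0"]] by simp
  ultimately show "((\<lambda>y. integral {0..y} f) \<longlongrightarrow> - F 0) at_top"
    by (rule Lim_transform_eventually[rotated])
qed (use assms in auto)

locale stable_quartic =
  fixes a0 a1 a2 a3 :: real and f0 f1 f2 f3 :: "real \<Rightarrow> real"
  assumes a0: "a0 \<ge> 0" and a1: "a1 > 0" and a3: "a3 > 0"
    and hurwitz: "a1 * (a3 * a2 - a1) - a3\<^sup>2 * a0 > 0"
    and f0: "\<And>t. (f0 has_real_derivative f1 t) (at t)"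
    and f1: "\<And>t. (f1 has_real_derivative f2 t) (at t)"
    and f2: "\<And>t. (f2 has_real_derivative f3 t) (at t)"
    and f3: "\<And>t. (f3 has_real_derivative - (a3 * f3 t + a2 * f2 t + a1 * f1 t + a0 * f0 t)) (at t)"
begin

section \<open>Lyapunov function and energy identities of the quartic equation\<close>

lemmas derivs = f0 f1 f2 f3

definition \<Delta> :: real where "\<Delta> = a1 * (a3 * a2 - a1) - a3\<^sup>2 * a0"

text \<open>Each \<open>Tk\<close> is what is left of the product of the equation with \<open>fk\<close> after integration by parts:
  its derivative only contains squares.\<close>

definition T0 :: "real \<Rightarrow> real" where
  "T0 t = f3 t * f0 t - f2 t * f1 t + a3 * (f2 t * f0 t - (f1 t)\<^sup>2 / 2) + a2 * f0 t * f1 t + a1 * (f0 t)\<^sup>2 / 2"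

definition T1 :: "real \<Rightarrow> real" where
  "T1 t = f3 t * f1 t - (f2 t)\<^sup>2 / 2 + a3 * f1 t * f2 t + a2 * (f1 t)\<^sup>2 / 2 + a0 * (f0 t)\<^sup>2 / 2"

definition T2 :: "real \<Rightarrow> real" where
  "T2 t = f3 t * f2 t + a3 * (f2 t)\<^sup>2 / 2 + a1 * (f1 t)\<^sup>2 / 2 + a0 * f0 t * f1 t"

definition T3 :: "real \<Rightarrow> real" where
  "T3 t = (f3 t)\<^sup>2 / 2 + a2 * (f2 t)\<^sup>2 / 2 + a1 * f1 t * f2 t + a0 * f0 t * f2 t - a0 * (f1 t)\<^sup>2 / 2"

text \<open>The combination of \<open>T1\<close>, \<open>T2\<close>, \<open>T3\<close> from whose derivative all squares but that of \<open>f2\<close>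
  cancel.\<close>

definition S :: "real \<Rightarrow> real" where
  "S t = a1 * (a3 * T2 t + T3 t) + a3 * a0 * T1 t"

lemma \<Delta>_pos: "\<Delta> > 0"
  using hurwitz by (simp add: \<Delta>_def)

lemma T0_deriv: "(T0 has_real_derivative a2 * (f1 t)\<^sup>2 - (f2 t)\<^sup>2 - a0 * (f0 t)\<^sup>2) (at t)"
  unfolding T0_def
  by (rule derivative_eq_intros derivs refl | simp)+ (simp add: power2_eq_square algebra_simps)

lemma T1_deriv: "(T1 has_real_derivative a3 * (f2 t)\<^sup>2 - a1 * (f1 t)\<^sup>2) (at t)"
  unfolding T1_def
  by (rule derivative_eq_intros derivs refl | simp)+ (simp add: power2_eq_square algebra_simps)

lemma T2_deriv: "(T2 has_real_derivative (f3 t)\<^sup>2 - a2 * (f2 t)\<^sup>2 + a0 * (f1 t)\<^sup>2) (at t)"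
  unfolding T2_def
  by (rule derivative_eq_intros derivs refl | simp)+ (simp add: power2_eq_square algebra_simps)

lemma T3_deriv: "(T3 has_real_derivative a1 * (f2 t)\<^sup>2 - a3 * (f3 t)\<^sup>2) (at t)"
  unfolding T3_def
  by (rule derivative_eq_intros derivs refl | simp)+ (simp add: power2_eq_square algebra_simps)

text \<open>The weights in \<open>S\<close> cancel the squares of \<open>f1\<close> and
  \<open>f3\<close>; what remains at the square of \<open>f2\<close> is minus the Hurwitz
  determinant.\<close>

lemma S_deriv: "(S has_real_derivative - \<Delta> * (f2 t)\<^sup>2) (at t)"
  unfolding S_def
  by (rule derivative_eq_intros T1_deriv T2_deriv T3_deriv refl | simp)+
    (simp add: \<Delta>_def power2_eq_square algebra_simps)

text \<open>Completing the square first in \<open>f3 t\<close>, then in \<open>a1 * f1 t + a0 * f0 t\<close>.\<close>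

lemma S_eq:
  "2 * S t = a1 * (f3 t + a3 * f2 t + a3 * a0 / a1 * f1 t)\<^sup>2
    + a3 * (a1 * f1 t + a0 * f0 t + a1 / a3 * f2 t)\<^sup>2
    + \<Delta> / a3 * (f2 t)\<^sup>2 + a0 * \<Delta> / a1 * (f1 t)\<^sup>2"
  using a1 a3
  by (simp add: S_def T1_def T2_def T3_def \<Delta>_def field_simps power2_eq_square)

text \<open>The four terms of \<open>S_eq\<close> are nonnegative, so each is at most their sum. For
  \<open>a0 = 0\<close> the last bound carries no information about \<open>f1\<close>.\<close>

lemma S_bounds:
  "a1 * (f3 t + a3 * f2 t + a3 * a0 / a1 * f1 t)\<^sup>2 \<le> 2 * S t"
  "a3 * (a1 * f1 t + a0 * f0 t + a1 / a3 * f2 t)\<^sup>2 \<le> 2 * S t"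
  "\<Delta> / a3 * (f2 t)\<^sup>2 \<le> 2 * S t"
  "a0 * \<Delta> / a1 * (f1 t)\<^sup>2 \<le> 2 * S t"
proof -
  have "a1 * (f3 t + a3 * f2 t + a3 * a0 / a1 * f1 t)\<^sup>2 \<ge> 0"
    "a3 * (a1 * f1 t + a0 * f0 t + a1 / a3 * f2 t)\<^sup>2 \<ge> 0"
    "\<Delta> / a3 * (f2 t)\<^sup>2 \<ge> 0" "a0 * \<Delta> / a1 * (f1 t)\<^sup>2 \<ge> 0"
    using a0 a1 a3 \<Delta>_pos by simp_all
  then show "a1 * (f3 t + a3 * f2 t + a3 * a0 / a1 * f1 t)\<^sup>2 \<le> 2 * S t"
    "a3 * (a1 * f1 t + a0 * f0 t + a1 / a3 * f2 t)\<^sup>2 \<le> 2 * S t"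
    "\<Delta> / a3 * (f2 t)\<^sup>2 \<le> 2 * S t" "a0 * \<Delta> / a1 * (f1 t)\<^sup>2 \<le> 2 * S t"
    unfolding S_eq by linarith+
qed

lemma S_nonneg: "S t \<ge> 0"
  using S_bounds(1)[of t] a1 by (smt (verit) mult_nonneg_nonneg zero_le_power2)

lemma S_antimono: "antimono S"
proof (rule antimonoI)
  show "S t \<le> S s" if "s \<le> t" for s t
  proof (rule DERIV_nonpos_imp_nonincreasing[OF that])
    show "\<exists>y. (S has_real_derivative y) (at x) \<and> y \<le> 0" for x
      using S_deriv[of x] \<Delta>_pos by (intro exI[of _ "- \<Delta> * (f2 x)\<^sup>2"]) simp
  qed
qed

lemma bounded_if_square_le_S:
  assumes "c > 0" and "\<And>t. c * (g t)\<^sup>2 \<le> 2 * S t"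
  obtains K where "\<And>t. t \<ge> 0 \<Longrightarrow> \<bar>g t\<bar> \<le> K"
proof
  fix t :: real assume "t \<ge> 0"
  then have "c * (g t)\<^sup>2 \<le> 2 * S 0" using assms(2)[of t] antimonoD[OF S_antimono] by fastforce
  then have "(g t)\<^sup>2 \<le> 2 * S 0 / c" using \<open>c > 0\<close> by (simp add: field_simps)
  then show "\<bar>g t\<bar> \<le> sqrt (2 * S 0 / c)" using real_le_rsqrt by fastforce
qed

text \<open>\<open>derivative_tendsto_zero\<close> yields in turn the limits of \<open>f2\<close>,
  \<open>f3\<close> and the fourth derivative \<open>f4\<close>; the equation then gives that of
  \<open>u\<close>, and differentiating \<open>u\<close> gives that of \<open>a0 * f1\<close>. The
  factor \<open>a0\<close> in the last claim is essential: for \<open>a0 = 0\<close> a nonzero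
  constant \<open>f0\<close> is a solution.\<close>

lemma decay:
  shows "(f1 \<longlongrightarrow> 0) at_top" "(f2 \<longlongrightarrow> 0) at_top" "(f3 \<longlongrightarrow> 0) at_top"
    "((\<lambda>t. a0 * f0 t) \<longlongrightarrow> 0) at_top"
proof -
  define u where "u t = a1 * f1 t + a0 * f0 t" for t
  define f4 where "f4 t = - (a3 * f3 t + a2 * f2 t + u t)" for t
  have u': "(u has_real_derivative a1 * f2 t + a0 * f1 t) (at t)" for t
    unfolding u_def by (rule derivative_eq_intros derivs refl | simp)+
  have u'': "((\<lambda>t. a1 * f2 t + a0 * f1 t) has_real_derivative a1 * f3 t + a0 * f2 t) (at t)" for t
    by (rule derivative_eq_intros derivs refl | simp)+
  have f3': "(f3 has_real_derivative f4 t) (at t)" for t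
    using f3[of t] by (simp add: f4_def u_def algebra_simps)
  have f4': "(f4 has_real_derivative - (a3 * f4 t + a2 * f3 t + (a1 * f2 t + a0 * f1 t))) (at t)" for t
    unfolding f4_def by (rule derivative_eq_intros f2 f3' u' refl | simp add: f4_def)+

  obtain K2 where K2: "\<And>t. t \<ge> 0 \<Longrightarrow> \<bar>f2 t\<bar> \<le> K2"
    using bounded_if_square_le_S[of "\<Delta> / a3" f2] S_bounds(3) \<Delta>_pos a3 by auto
  \<comment> \<open>Only the product with \<open>a0\<close> is bounded, as the fourth bound on
    \<open>S\<close> degenerates at \<open>a0 = 0\<close>; every later use of a bound on
    \<open>f1\<close> has this factor.\<close>
  obtain K1 where K1: "\<And>t. t \<ge> 0 \<Longrightarrow> \<bar>a0 * f1 t\<bar> \<le> K1"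
  proof (cases "a0 = 0")
    case False
    then have "\<Delta> / (a0 * a1) * (a0 * f1 t)\<^sup>2 = a0 * \<Delta> / a1 * (f1 t)\<^sup>2" for t
      by (simp add: power2_eq_square)
    then have "\<Delta> / (a0 * a1) * (a0 * f1 t)\<^sup>2 \<le> 2 * S t" for t
      using S_bounds(4)[of t] by simp
    then show ?thesis
      using bounded_if_square_le_S[of "\<Delta> / (a0 * a1)" "\<lambda>t. a0 * f1 t"] \<Delta>_pos a0 a1 False that by auto
  qed (use that[of 0] in auto)
  have lin: "\<bar>c * x\<bar> \<le> \<bar>c\<bar> * K" if "\<bar>x\<bar> \<le> K" for c x K :: real
    using that by (simp add: abs_mult mult_left_mono)
  obtain K3' where K3': "\<And>t. t \<ge> 0 \<Longrightarrow> \<bar>f3 t + a3 * f2 t + a3 * a0 / a1 * f1 t\<bar> \<le> K3'"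
    using bounded_if_square_le_S[OF a1 S_bounds(1)] by blast
  define K3 where "K3 = K3' + \<bar>a3\<bar> * K2 + \<bar>a3 / a1\<bar> * K1"
  have K3: "\<bar>f3 t\<bar> \<le> K3" if "t \<ge> 0" for t
  proof -
    have "a3 * a0 / a1 * f1 t = a3 / a1 * (a0 * f1 t)" by simp
    moreover have "\<bar>x\<bar> \<le> A + B + C" if "\<bar>x + y + z\<bar> \<le> A" "\<bar>y\<bar> \<le> B" "\<bar>z\<bar> \<le> C"
      for x y z A B C :: real using that by linarith
    ultimately show ?thesis
      using K3'[OF that] lin[OF K2[OF that], of a3] lin[OF K1[OF that], of "a3 / a1"]
      unfolding K3_def by metis
  qed
  obtain Ku' where Ku': "\<And>t. t \<ge> 0 \<Longrightarrow> \<bar>a1 * f1 t + a0 * f0 t + a1 / a3 * f2 t\<bar> \<le> Ku'"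
    using bounded_if_square_le_S[OF a3 S_bounds(2)] by blast
  define Ku where "Ku = Ku' + \<bar>a1 / a3\<bar> * K2"
  have Ku: "\<bar>u t\<bar> \<le> Ku" if "t \<ge> 0" for t
    using Ku'[OF that] lin[OF K2[OF that], of "a1 / a3"] unfolding Ku_def u_def by linarith
  define K4 where "K4 = \<bar>a3\<bar> * K3 + \<bar>a2\<bar> * K2 + Ku"
  have K4: "\<bar>f4 t\<bar> \<le> K4" if "t \<ge> 0" for t
    using lin[OF K3[OF that], of a3] lin[OF K2[OF that], of a2] Ku[OF that]
    unfolding K4_def f4_def by linarith

  \<comment> \<open>LaSalle's argument: \<open>S\<close> converges, so \<open>f2\<close> tends to \<open>0\<close>, and then so does every
    function obtained from it by differentiation or by the equation.\<close>
  obtain l where l: "(S \<longlongrightarrow> l) at_top"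
    using antimono_tendsto_at_top[OF S_antimono S_nonneg] by blast
  have "((\<lambda>t. - \<Delta> * (f2 t)\<^sup>2) \<longlongrightarrow> 0) at_top"
  proof (rule derivative_tendsto_zero[OF S_deriv _ _ l])
    show "((\<lambda>t. - \<Delta> * (f2 t)\<^sup>2) has_real_derivative - \<Delta> * 2 * (f2 t * f3 t)) (at t)" for t
      by (rule derivative_eq_intros derivs refl | simp)+
    have "\<bar>f2 t * f3 t\<bar> \<le> K2 * K3" if "t \<ge> 0" for t
      unfolding abs_mult using K2[OF that] K3[OF that] by (intro mult_mono) auto
    then show "\<bar>- \<Delta> * 2 * (f2 t * f3 t)\<bar> \<le> \<bar>- \<Delta> * 2\<bar> * (K2 * K3)" if "t \<ge> 0" for t
      using lin that by blast
  qed
  then have "((\<lambda>t. (f2 t)\<^sup>2) \<longlongrightarrow> 0) at_top"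
    using tendsto_mult_left_iff[of "- \<Delta>" "\<lambda>t. (f2 t)\<^sup>2" 0 at_top] \<Delta>_pos by simp
  from tendsto_real_sqrt[OF this] show f2_lim: "(f2 \<longlongrightarrow> 0) at_top"
    by (simp add: tendsto_rabs_zero_iff)
  show f3_lim: "(f3 \<longlongrightarrow> 0) at_top"
    by (rule derivative_tendsto_zero[OF f2 f3' K4 f2_lim])
  have f4_lim: "(f4 \<longlongrightarrow> 0) at_top"
  proof (rule derivative_tendsto_zero[OF f3' f4' _ f3_lim])
    show "\<bar>- (a3 * f4 t + a2 * f3 t + (a1 * f2 t + a0 * f1 t))\<bar>
        \<le> \<bar>a3\<bar> * K4 + \<bar>a2\<bar> * K3 + \<bar>a1\<bar> * K2 + K1" if "t \<ge> 0" for t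
      using lin[OF K4[OF that], of a3] lin[OF K3[OF that], of a2] lin[OF K2[OF that], of a1] K1[OF that]
      by linarith
  qed
  \<comment> \<open>The equation itself, solved for \<open>u\<close>.\<close>
  have "((\<lambda>t. - f4 t - a3 * f3 t - a2 * f2 t) \<longlongrightarrow> - 0 - a3 * 0 - a2 * 0) at_top"
    by (intro tendsto_intros f2_lim f3_lim f4_lim)
  moreover have "(\<lambda>t. - f4 t - a3 * f3 t - a2 * f2 t) = u" by (auto simp: f4_def)
  ultimately have u_lim: "(u \<longlongrightarrow> 0) at_top" by simp
  have "((\<lambda>t. a1 * f2 t + a0 * f1 t) \<longlongrightarrow> 0) at_top"
  proof (rule derivative_tendsto_zero[OF u' u'' _ u_lim])
    show "\<bar>a1 * f3 t + a0 * f2 t\<bar> \<le> \<bar>a1\<bar> * K3 + \<bar>a0\<bar> * K2" if "t \<ge> 0" for t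
      using lin[OF K3[OF that], of a1] lin[OF K2[OF that], of a0] by linarith
  qed
  from tendsto_diff[OF this tendsto_mult_right_zero[OF f2_lim, of a1]]
  have a0f1: "((\<lambda>t. a0 * f1 t) \<longlongrightarrow> 0) at_top" by simp
  \<comment> \<open>For \<open>a0 = 0\<close> the function \<open>u\<close> reduces to
    \<open>a1 * f1\<close>; otherwise \<open>a0\<close> can be divided out.\<close>
  show f1_lim: "(f1 \<longlongrightarrow> 0) at_top"
  proof (cases "a0 = 0")
    case True
    then show ?thesis using u_lim a1 tendsto_mult_left_iff[of a1 f1 0 at_top] by (simp add: u_def[abs_def])
  next
    case False
    then show ?thesis using a0f1 tendsto_mult_left_iff[of a0 f1 0 at_top] by simp
  qed
  from tendsto_diff[OF u_lim tendsto_mult_right_zero[OF f1_lim, of a1]]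
  show "((\<lambda>t. a0 * f0 t) \<longlongrightarrow> 0) at_top" by (simp add: u_def)
qed

lemma f0_lim: "a0 > 0 \<Longrightarrow> (f0 \<longlongrightarrow> 0) at_top"
  using decay(4) tendsto_mult_left_iff[of a0 f0 0 at_top] by simp

lemma T1_lim: "(T1 \<longlongrightarrow> 0) at_top"
proof -
  have "((\<lambda>t. a0 * (f0 t)\<^sup>2 / 2) \<longlongrightarrow> 0) at_top"
  proof (cases "a0 = 0")
    case False
    then have "((\<lambda>t. a0 * (f0 t)\<^sup>2 / 2) \<longlongrightarrow> a0 * 0\<^sup>2 / 2) at_top"
      using a0 by (intro tendsto_intros f0_lim) auto
    then show ?thesis by simp
  qed auto
  then have "(T1 \<longlongrightarrow> 0 * 0 - 0\<^sup>2 / 2 + a3 * 0 * 0 + a2 * 0\<^sup>2 / 2 + 0) at_top"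
    unfolding T1_def by (intro tendsto_intros decay) auto
  then show ?thesis by simp
qed

lemma S_lim: "(S \<longlongrightarrow> 0) at_top"
proof -
  have "(S \<longlongrightarrow> a1 * (a3 * (0 * 0 + a3 * 0\<^sup>2 / 2 + a1 * 0\<^sup>2 / 2 + 0 * 0)
      + (0\<^sup>2 / 2 + a2 * 0\<^sup>2 / 2 + a1 * 0 * 0 + 0 * 0 - a0 * 0\<^sup>2 / 2)) + a3 * a0 * 0) at_top"
    unfolding S_def T2_def T3_def by (intro tendsto_intros decay T1_lim) auto
  then show ?thesis by simp
qed

text \<open>\<open>I1\<close> and \<open>I2\<close> are the integrals of the squares of
  \<open>f1\<close> and \<open>f2\<close> over the half-line, obtained by integrating
  \<open>S_deriv\<close> and \<open>T1_deriv\<close> with zero limits at infinity.\<close>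

definition I1 :: real where "I1 = (a3 * S 0 / \<Delta> + T1 0) / a1"
definition I2 :: real where "I2 = S 0 / \<Delta>"

text \<open>If \<open>a0 = 0\<close>, the function \<open>f0\<close> need not decay. Then \<open>p = 0\<close>, and \<open>p\<^sup>2 / a0 = 0\<close> is the
  intended value.\<close>

lemma output_energy:
  assumes "p = 0 \<or> a0 > 0"
  shows "((\<lambda>t. (p * f0 t + q * f1 t + r * f2 t)\<^sup>2) has_integral
    (q\<^sup>2 - 2 * p * r + p\<^sup>2 / a0 * a2) * I1 + (r\<^sup>2 - p\<^sup>2 / a0) * I2 + p\<^sup>2 / a0 * T0 0
      - (2 * p * r * f0 0 * f1 0 + p * q * (f0 0)\<^sup>2 + q * r * (f1 0)\<^sup>2)) {0..}"
proof -
  \<comment> \<open>The multiple of \<open>T0_deriv\<close> that trades the square of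
    \<open>p * f0\<close> for squares of \<open>f1\<close> and \<open>f2\<close>.\<close>
  define \<kappa> where "\<kappa> = p\<^sup>2 / a0"
  have \<kappa>: "\<kappa> * a0 = p\<^sup>2" using assms by (auto simp: \<kappa>_def)
  define F1 where "F1 t = - (a3 * S t / \<Delta> + T1 t) / a1" for t
  define F2 where "F2 t = - S t / \<Delta>" for t
  \<comment> \<open>An antiderivative of the squared output. The mixed products integrate exactly,
    except that \<open>f0 * f2\<close> is the derivative of \<open>f0 * f1\<close> minus the square
    of \<open>f1\<close>, whence the term \<open>- 2 * p * r\<close>.\<close>
  define F where "F t = (q\<^sup>2 - 2 * p * r + \<kappa> * a2) * F1 t + (r\<^sup>2 - \<kappa>) * F2 t - \<kappa> * T0 t
      + (2 * r * (p * f0 t) * f1 t + q * (p * f0 t) * f0 t + q * r * (f1 t)\<^sup>2)" for t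
  have F2': "(F2 has_real_derivative (f2 t)\<^sup>2) (at t)" for t
    unfolding F2_def using \<Delta>_pos
    by (auto intro!: derivative_eq_intros S_deriv)
  have F1': "(F1 has_real_derivative (f1 t)\<^sup>2) (at t)" for t
    unfolding F1_def using \<Delta>_pos a1
    by (auto intro!: derivative_eq_intros S_deriv T1_deriv simp: field_simps)
  have F': "(F has_real_derivative (p * f0 t + q * f1 t + r * f2 t)\<^sup>2) (at t)" for t
  proof -
    have *: "\<kappa> * (a0 * (f0 t)\<^sup>2) = p\<^sup>2 * (f0 t)\<^sup>2" by (simp flip: \<kappa>)
    have "(F has_real_derivative (q\<^sup>2 - 2 * p * r + \<kappa> * a2) * (f1 t)\<^sup>2 + (r\<^sup>2 - \<kappa>) * (f2 t)\<^sup>2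
        - \<kappa> * (a2 * (f1 t)\<^sup>2 - (f2 t)\<^sup>2 - a0 * (f0 t)\<^sup>2)
        + (2 * r * p * (f0 t * f2 t + (f1 t)\<^sup>2) + 2 * q * p * f0 t * f1 t + 2 * q * r * f1 t * f2 t)) (at t)"
      unfolding F_def
      by (rule derivative_eq_intros F1' F2' T0_deriv derivs refl)+ (simp add: algebra_simps power2_eq_square)
    also have "(q\<^sup>2 - 2 * p * r + \<kappa> * a2) * (f1 t)\<^sup>2 + (r\<^sup>2 - \<kappa>) * (f2 t)\<^sup>2
        - \<kappa> * (a2 * (f1 t)\<^sup>2 - (f2 t)\<^sup>2 - a0 * (f0 t)\<^sup>2)
        + (2 * r * p * (f0 t * f2 t + (f1 t)\<^sup>2) + 2 * q * p * f0 t * f1 t + 2 * q * r * f1 t * f2 t)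
      = (p * f0 t + q * f1 t + r * f2 t)\<^sup>2"
      using * by algebra
    finally show ?thesis .
  qed
  have pf0: "((\<lambda>t. p * f0 t) \<longlongrightarrow> 0) at_top"
    using assms f0_lim tendsto_mult_right_zero by auto
  have pf00: "((\<lambda>t. q * (p * f0 t) * f0 t) \<longlongrightarrow> 0) at_top"
    using assms
  proof
    assume "a0 > 0"
    from tendsto_mult_zero[OF tendsto_mult_right_zero[OF pf0, of q] f0_lim[OF this]]
    show ?thesis by simp
  qed simp
  have T0_lim: "((\<lambda>t. \<kappa> * T0 t) \<longlongrightarrow> 0) at_top"
  proof (cases "p = 0")
    case False
    then have "(T0 \<longlongrightarrow> 0 * 0 - 0 * 0 + a3 * (0 * 0 - 0\<^sup>2 / 2) + a2 * 0 * 0 + a1 * 0\<^sup>2 / 2) at_top"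
      unfolding T0_def using assms by (intro tendsto_intros decay f0_lim) auto
    then show ?thesis by (intro tendsto_mult_right_zero) simp
  qed (auto simp: \<kappa>_def)
  have "(F \<longlongrightarrow> (q\<^sup>2 - 2 * p * r + \<kappa> * a2) * (- (a3 * 0 / \<Delta> + 0) / a1)
      + (r\<^sup>2 - \<kappa>) * (- 0 / \<Delta>) - 0 + (2 * r * 0 * 0 + 0 + q * r * 0\<^sup>2)) at_top"
    unfolding F_def F1_def F2_def
    using a1 \<Delta>_pos by (intro tendsto_intros S_lim T1_lim T0_lim pf0 pf00 decay) auto
  then have "(F \<longlongrightarrow> 0) at_top" by simp
  from has_integral_antiderivative_to_inf[OF F' _ this]
  have "((\<lambda>t. (p * f0 t + q * f1 t + r * f2 t)\<^sup>2) has_integral - F 0) {0..}" by simp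
  moreover have "F1 0 = - I1" "F2 0 = - I2"
    by (simp_all only: F1_def F2_def I1_def I2_def minus_divide_left)
  then have "- F 0 = (q\<^sup>2 - 2 * p * r + p\<^sup>2 / a0 * a2) * I1 + (r\<^sup>2 - p\<^sup>2 / a0) * I2 + p\<^sup>2 / a0 * T0 0
      - (2 * p * r * f0 0 * f1 0 + p * q * (f0 0)\<^sup>2 + q * r * (f1 0)\<^sup>2)"
    unfolding F_def \<kappa>_def[symmetric] by (simp add: power2_eq_square algebra_simps)
  ultimately show ?thesis by (simp only:)
qed

end


section \<open>One mode of the closed-loop system\<close>

definition dpiac_b1 :: "real \<Rightarrow> real \<Rightarrow> real \<Rightarrow> real \<Rightarrow> real \<Rightarrow> real" where
  "dpiac_b1 m d k1 k3 l = l\<^sup>2 * (4 * k1\<^sup>2 * k3 * m - 1)\<^sup>2 + 4 * d * m * k1^3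
        + k1 * (d + 4 * k1 * m) * (4 * d * l * k1 * k3 + 5 * l + 4 * d * k1)"

definition dpiac_b2 :: "real \<Rightarrow> real \<Rightarrow> real \<Rightarrow> real \<Rightarrow> real \<Rightarrow> real" where
  "dpiac_b2 m d k1 k3 l = 2 * d * k1^3 * (d + 2 * k1 * m)\<^sup>2
        + 2 * l * k1^4 * m\<^sup>2 * (4 * k1 * k3 * d + 4)"

definition dpiac_e :: "real \<Rightarrow> real \<Rightarrow> real \<Rightarrow> real \<Rightarrow> real \<Rightarrow> real" where
  "dpiac_e m d k1 k3 l = d * l\<^sup>2 * (4 * k1\<^sup>2 * k3 * m - 1)\<^sup>2
        + 16 * d * l * k1^4 * k3 * m\<^sup>2 + d\<^sup>2 * l * k1
        + 4 * k1 * (d + 2 * k1 * m)\<^sup>2 * (d * k1 + l + d * l * k1 * k3)"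

text \<open>The summand containing \<open>d * k1\<close> stays positive even at
  \<open>l = 0\<close>; the others are nonnegative.\<close>

lemma dpiac_e_pos:
  assumes "m > 0" "d > 0" "k1 > 0" "k3 > 0" "l \<ge> 0"
  shows "dpiac_e m d k1 k3 l > 0"
proof -
  have "4 * k1 * (d + 2 * k1 * m)\<^sup>2 * (d * k1 + l + d * l * k1 * k3) > 0"
    using assms by (intro mult_pos_pos add_pos_nonneg zero_less_power) auto
  moreover have "d * l\<^sup>2 * (4 * k1\<^sup>2 * k3 * m - 1)\<^sup>2 \<ge> 0" "16 * d * l * k1^4 * k3 * m\<^sup>2 \<ge> 0" "d\<^sup>2 * l * k1 \<ge> 0"
    using assms by auto
  ultimately show ?thesis unfolding dpiac_e_def by linarith
qed

text \<open>Differentiating the frequency equation twice more eliminates \<eta> and \<xi> and leaves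
  a stable quartic equation for \<theta>. Both outputs are combinations of \<theta> and its first
  two derivatives, so \<open>output_energy\<close> applies.\<close>

lemma dpiac_mode_energy:
  fixes \<theta> \<omega> \<eta> \<xi> :: "real \<Rightarrow> real"
  assumes pos: "m > 0" "d > 0" "k1 > 0" "k3 > 0" and l: "l \<ge> 0"
    and \<theta>: "\<And>t. (\<theta> has_real_derivative \<omega> t) (at t)"
    and \<omega>: "\<And>t. (\<omega> has_real_derivative (- l * \<theta> t - d * \<omega> t + 4 * k1 * \<xi> t) / m) (at t)"
    and \<eta>: "\<And>t. (\<eta> has_real_derivative d * \<omega> t + 4 * k1 * k3 * l * \<xi> t) (at t)"
    and \<xi>: "\<And>t. (\<xi> has_real_derivative - k1 * m * \<omega> t - k1 * \<eta> t - 4 * k1 * \<xi> t) (at t)"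
    and init: "\<theta> 0 = 0" "\<omega> 0 = c / m" "\<eta> 0 = 0" "\<xi> 0 = 0"
  shows "((\<lambda>t. (\<omega> t)\<^sup>2) has_integral c\<^sup>2 * (1 / (2 * m) * (dpiac_b1 m d k1 k3 l / dpiac_e m d k1 k3 l))) {0..}"
    and "((\<lambda>t. (4 * k1 * \<xi> t)\<^sup>2) has_integral c\<^sup>2 * (dpiac_b2 m d k1 k3 l / dpiac_e m d k1 k3 l)) {0..}"
proof -
  \<comment> \<open>\<alpha> and \<beta> are the first and second derivatives of \<omega>;
    \<open>c0\<close> to \<open>c3\<close> are the coefficients of the characteristic polynomial of
    the mode, with \<open>c0 = 0\<close> exactly when \<open>l = 0\<close>.\<close>
  define \<alpha> where "\<alpha> t = (- l * \<theta> t - d * \<omega> t + 4 * k1 * \<xi> t) / m" for t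
  define \<beta> where "\<beta> t = (- l * \<omega> t - d * \<alpha> t + 4 * k1 * (- k1 * m * \<omega> t - k1 * \<eta> t - 4 * k1 * \<xi> t)) / m" for t
  define c0 where "c0 = 4 * k1\<^sup>2 * k3 * l\<^sup>2 / m"
  define c1 where "c1 = 4 * k1 * (d * k1 + l + d * l * k1 * k3) / m"
  define c2 where "c2 = (4 * k1\<^sup>2 * k3 * l * m + 4 * k1 * d + l + 4 * k1\<^sup>2 * m) / m"
  define c3 where "c3 = (4 * k1 * m + d) / m"
  let ?e = "dpiac_e m d k1 k3 l"
  have e: "?e > 0" using dpiac_e_pos pos l by blast
  have c1: "c1 > 0"
    unfolding c1_def using pos l by (intro divide_pos_pos mult_pos_pos add_pos_nonneg) auto
  have \<Delta>: "c1 * (c3 * c2 - c1) - c3\<^sup>2 * c0 = 4 * k1 * ?e / m^3"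
    using pos unfolding c0_def c1_def c2_def c3_def dpiac_e_def
    by (simp add: divide_simps) algebra
  interpret stable_quartic c0 c1 c2 c3 \<theta> \<omega> \<alpha> \<beta>
  proof
    show "c0 \<ge> 0" "c1 > 0" "c3 > 0" using pos c1 by (simp_all add: c0_def c3_def add_pos_pos)
    show "c1 * (c3 * c2 - c1) - c3\<^sup>2 * c0 > 0" unfolding \<Delta> using pos e by simp
    show \<alpha>: "(\<omega> has_real_derivative \<alpha> t) (at t)" for t using \<omega> by (simp add: \<alpha>_def)
    show \<beta>: "(\<alpha> has_real_derivative \<beta> t) (at t)" for t
      unfolding \<alpha>_def[abs_def] using pos
      by (auto intro!: derivative_eq_intros \<theta> \<alpha> \<xi> simp: \<beta>_def)
    have "(\<beta> has_real_derivative (- l * \<alpha> t - d * \<beta> t + 4 * k1 * (- k1 * m * \<alpha> t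
        - k1 * (d * \<omega> t + 4 * k1 * k3 * l * \<xi> t)
        - 4 * k1 * (- k1 * m * \<omega> t - k1 * \<eta> t - 4 * k1 * \<xi> t))) / m) (at t)" for t
      unfolding \<beta>_def[abs_def] using pos
      by (auto intro!: derivative_eq_intros \<alpha> \<beta> \<eta> \<xi>) (simp add: \<beta>_def algebra_simps)
    moreover have "(- l * \<alpha> t - d * \<beta> t + 4 * k1 * (- k1 * m * \<alpha> t
        - k1 * (d * \<omega> t + 4 * k1 * k3 * l * \<xi> t)
        - 4 * k1 * (- k1 * m * \<omega> t - k1 * \<eta> t - 4 * k1 * \<xi> t))) / m
        = - (c3 * \<beta> t + c2 * \<alpha> t + c1 * \<omega> t + c0 * \<theta> t)" for t
    proof -
      have "m * \<alpha> t = - l * \<theta> t - d * \<omega> t + 4 * k1 * \<xi> t"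
        "m * \<beta> t = - l * \<omega> t - d * \<alpha> t + 4 * k1 * (- k1 * m * \<omega> t - k1 * \<eta> t - 4 * k1 * \<xi> t)"
        using pos by (simp_all add: \<alpha>_def \<beta>_def)
      then show ?thesis
        using pos unfolding c0_def c1_def c2_def c3_def
        by (simp add: divide_simps) algebra
    qed
    ultimately show "(\<beta> has_real_derivative - (c3 * \<beta> t + c2 * \<alpha> t + c1 * \<omega> t + c0 * \<theta> t)) (at t)" for t
      by simp
  qed (rule \<theta>)
  have init': "\<alpha> 0 = - d * c / m\<^sup>2" "\<beta> 0 = c * (d\<^sup>2 - l * m - 4 * k1\<^sup>2 * m\<^sup>2) / m^3"
    using pos unfolding \<beta>_def \<alpha>_def init by (simp_all add: field_simps power2_eq_square power3_eq_cube)
  have \<Delta>': "\<Delta> = 4 * k1 * ?e / m^3" using \<Delta> by (simp add: \<Delta>_def)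
  have I2: "I2 = S 0 * m^3 / (4 * k1 * ?e)" by (simp add: I2_def \<Delta>')
  obtain s t1 where st: "S 0 = s" "T1 0 = t1" by blast
  have t1: "t1 = \<beta> 0 * (c / m) - (\<alpha> 0)\<^sup>2 / 2 + c3 * (c / m) * \<alpha> 0 + c2 * (c / m)\<^sup>2 / 2"
    by (simp add: T1_def init flip: st)
  have s: "s = c1 * (c3 * (\<beta> 0 * \<alpha> 0 + c3 * (\<alpha> 0)\<^sup>2 / 2 + c1 * (c / m)\<^sup>2 / 2)
      + ((\<beta> 0)\<^sup>2 / 2 + c2 * (\<alpha> 0)\<^sup>2 / 2 + c1 * (c / m) * \<alpha> 0 - c0 * (c / m)\<^sup>2 / 2)) + c3 * c0 * t1"
    by (simp add: S_def T2_def T3_def init flip: st)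
  have I1: "I1 = c\<^sup>2 * (1 / (2 * m) * (dpiac_b1 m d k1 k3 l / ?e))"
  proof -
    \<comment> \<open>Denominators cleared, this says that the numerator of \<open>I1\<close> is
      divisible by \<open>c1\<close>, so that \<open>c1\<close> is absent from the final
      formula.\<close>
    have "c3 * s * m^3 + t1 * (4 * k1 * ?e) = 4 * k1 * c1 * (c\<^sup>2 * dpiac_b1 m d k1 k3 l / (2 * m))"
      using pos unfolding s t1 init' c0_def c1_def c2_def c3_def dpiac_e_def dpiac_b1_def
      by (simp add: divide_simps) algebra
    then show ?thesis
      using c1 e pos unfolding I1_def st \<Delta>' by (simp add: divide_simps) algebra
  qed
  show "((\<lambda>t. (\<omega> t)\<^sup>2) has_integral c\<^sup>2 * (1 / (2 * m) * (dpiac_b1 m d k1 k3 l / ?e))) {0..}"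
    using output_energy[of 0 1 0] by (simp add: I1)
  \<comment> \<open>The frequency equation solved for the control: the output with coefficients
    \<open>l\<close>, \<open>d\<close>, \<open>m\<close>.\<close>
  have u: "4 * k1 * \<xi> t = l * \<theta> t + d * \<omega> t + m * \<alpha> t" for t
    using pos by (simp add: \<alpha>_def)
  have val: "(d\<^sup>2 - 2 * l * m + l\<^sup>2 / c0 * c2) * I1 + (m\<^sup>2 - l\<^sup>2 / c0) * I2 + l\<^sup>2 / c0 * T0 0
      - d * m * (c / m)\<^sup>2 = c\<^sup>2 * (dpiac_b2 m d k1 k3 l / ?e)"
  proof (cases "l = 0")
    \<comment> \<open>Here \<open>l\<^sup>2 / c0\<close> is 0 / 0, which is 0 by convention, so all
      its terms drop out. For \<open>l \<noteq> 0\<close> the quotient is a positive constant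
      independent of \<open>l\<close>, hence the case distinction.\<close>
    case True
    have "d\<^sup>2 * (c\<^sup>2 * dpiac_b1 m d k1 k3 0) * (2 * k1) + m\<^sup>2 * s * m^4 - d * c\<^sup>2 * (4 * k1 * dpiac_e m d k1 k3 0)
        = c\<^sup>2 * dpiac_b2 m d k1 k3 0 * (4 * k1 * m)"
      using pos unfolding s t1 init' c0_def c1_def c2_def c3_def dpiac_e_def dpiac_b1_def dpiac_b2_def True
      by (simp add: divide_simps) algebra
    then show ?thesis
      using e pos True unfolding I1 I2 st by (simp add: divide_simps) algebra
  next
    case False
    then have \<kappa>: "l\<^sup>2 / c0 = m / (4 * k1\<^sup>2 * k3)" using pos by (simp add: c0_def)
    obtain t0 where t0': "T0 0 = t0" by blast
    have t0: "t0 = - (\<alpha> 0 * (c / m)) - c3 * (c / m)\<^sup>2 / 2" by (simp add: T0_def init flip: t0')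
    define \<kappa> where "\<kappa> = m / (4 * k1\<^sup>2 * k3)"
    have "(d\<^sup>2 - 2 * l * m + \<kappa> * c2) * (c\<^sup>2 * dpiac_b1 m d k1 k3 l / (2 * m)) * (4 * k1)
        + (m\<^sup>2 - \<kappa>) * (s * m^3) + (\<kappa> * t0 - d * m * (c / m)\<^sup>2) * (4 * k1 * ?e)
        = 4 * k1 * (c\<^sup>2 * dpiac_b2 m d k1 k3 l)"
      using pos unfolding \<kappa>_def t0 s t1 init' c0_def c1_def c2_def c3_def
        dpiac_e_def dpiac_b1_def dpiac_b2_def
      by (simp add: divide_simps) algebra
    then show ?thesis
      using e pos unfolding \<kappa> \<kappa>_def[symmetric] I1 I2 st t0' by (simp add: divide_simps) algebra
  qed
  have "l = 0 \<or> c0 > 0" using pos by (cases "l = 0") (simp_all add: c0_def)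
  from output_energy[OF this, of d m]
  have "((\<lambda>t. (4 * k1 * \<xi> t)\<^sup>2) has_integral
    (d\<^sup>2 - 2 * l * m + l\<^sup>2 / c0 * c2) * I1 + (m\<^sup>2 - l\<^sup>2 / c0) * I2 + l\<^sup>2 / c0 * T0 0
      - (2 * l * m * 0 * (c / m) + l * d * 0\<^sup>2 + d * m * (c / m)\<^sup>2)) {0..}"
    unfolding u init .
  moreover have "2 * l * m * 0 * (c / m) + l * d * 0\<^sup>2 + d * m * (c / m)\<^sup>2 = d * m * (c / m)\<^sup>2" by simp
  ultimately show "((\<lambda>t. (4 * k1 * \<xi> t)\<^sup>2) has_integral c\<^sup>2 * (dpiac_b2 m d k1 k3 l / ?e)) {0..}"
    by (simp only: val)
qed

section \<open>Spectral decomposition of symmetric matrices\<close>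

text \<open>A maximizer of the quadratic form on the unit sphere of \<open>S\<close> is an
  eigenvector: invariance of \<open>S\<close> puts the residual \<open>w\<close> into
  \<open>S\<close>, where it is an admissible direction of variation.\<close>

lemma self_adjoint_has_eigenvector:
  fixes f :: "'a::euclidean_space \<Rightarrow> 'a"
  assumes lin: "linear f" and sa: "\<And>x y. f x \<bullet> y = x \<bullet> f y"
    and S: "subspace S" "f ` S \<subseteq> S" "S \<noteq> {0}"
  obtains v c where "v \<in> S" "norm v = 1" "f v = c *\<^sub>R v"
proof -
  interpret linear f by fact
  let ?K = "sphere 0 1 \<inter> S"
  obtain x where "x \<in> S" "x \<noteq> 0" using S subspace_0 by blast
  then have "x /\<^sub>R norm x \<in> ?K" using S(1) by (simp add: subspace_scale)
  moreover have "compact ?K" using S(1) by (intro compact_Int_closed closed_subspace) auto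
  moreover have "continuous_on ?K (\<lambda>x. x \<bullet> f x)"
    by (intro continuous_intros linear_continuous_on linear_conv_bounded_linear[THEN iffD1] lin)
  ultimately obtain v where v: "v \<in> ?K" and max: "\<And>x. x \<in> ?K \<Longrightarrow> x \<bullet> f x \<le> v \<bullet> f v"
    using continuous_attains_sup[of ?K "\<lambda>x. x \<bullet> f x"] by blast
  define c where "c = v \<bullet> f v"
  have vv: "v \<bullet> v = 1" using v by (simp add: dot_square_norm)
  have form: "c * (y \<bullet> y) - y \<bullet> f y \<ge> 0" if "y \<in> S" for y
  proof (cases "y = 0")
    case False
    then have "y /\<^sub>R norm y \<in> ?K" using that S(1) by (simp add: subspace_scale)
    from max[OF this] have "(y \<bullet> f y) / (norm y)\<^sup>2 \<le> c"
      by (simp add: scale c_def power2_eq_square divide_simps mult_ac)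
    then show ?thesis using False by (simp add: divide_simps dot_square_norm)
  qed (simp add: zero)
  \<comment> \<open>The form \<open>form\<close> is nonnegative and vanishes at \<open>v\<close>, so its derivative at \<open>v\<close> in the direction
    \<open>w\<close> vanishes; that derivative is \<open>2 * (w \<bullet> w)\<close>.\<close>
  define w where "w = c *\<^sub>R v - f v"
  have "w \<in> S" using v S unfolding w_def by (auto intro!: subspace_diff subspace_scale)
  define q where "q = c * (w \<bullet> w) - w \<bullet> f w"
  have vw: "v \<bullet> f w = c * (v \<bullet> w) - w \<bullet> w"
  proof -
    have "f v = c *\<^sub>R v - w" by (simp add: w_def)
    then have "f v \<bullet> w = c * (v \<bullet> w) - w \<bullet> w" by (simp add: inner_diff_left)
    then show ?thesis by (simp add: sa)
  qed
  have quad: "2 * t * (w \<bullet> w) + t\<^sup>2 * q \<ge> 0" for t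
  proof -
    have "v + t *\<^sub>R w \<in> S" using v \<open>w \<in> S\<close> S(1) by (auto intro!: subspace_add subspace_scale)
    from form[OF this] show ?thesis
      using vw sa[of v w]
      by (simp add: q_def add scale inner_add_left inner_add_right vv c_def[symmetric]
          inner_commute[of w v] inner_commute[of w "f v"] power2_eq_square) (simp add: algebra_simps)
  qed
  have "w \<bullet> w = 0"
  proof (rule ccontr)
    assume "w \<bullet> w \<noteq> 0"
    then have ww: "w \<bullet> w > 0" by simp
    \<comment> \<open>Negative, and small enough that the linear term dominates the quadratic
      one.\<close>
    define t where "t = - (w \<bullet> w) / (1 + \<bar>q\<bar>)"
    have "t < 0" using ww unfolding t_def by (simp add: divide_neg_pos)
    have "\<bar>t * q\<bar> \<le> w \<bullet> w" using ww by (simp add: t_def abs_mult field_simps)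
    then have "2 * (w \<bullet> w) + t * q > 0" using ww by linarith
    then have "t * (2 * (w \<bullet> w) + t * q) < 0" using \<open>t < 0\<close> by (rule mult_neg_pos[rotated])
    then show False using quad[of t] by (simp add: algebra_simps power2_eq_square)
  qed
  then have "f v = c *\<^sub>R v" by (simp add: w_def)
  then show thesis using that v by auto
qed

text \<open>Take an orthonormal set of eigenvectors of maximal cardinality. If it did not span, its
  orthogonal complement would be nonzero and invariant and would supply one more
  eigenvector.\<close>

lemma self_adjoint_eigenbasis:
  fixes f :: "'a::euclidean_space \<Rightarrow> 'a"
  assumes lin: "linear f" and sa: "\<And>x y. f x \<bullet> y = x \<bullet> f y"
  obtains B where "pairwise orthogonal B" "\<And>v. v \<in> B \<Longrightarrow> norm v = 1"
    "\<And>v. v \<in> B \<Longrightarrow> \<exists>c. f v = c *\<^sub>R v" "independent B" "span B = UNIV"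
proof -
  interpret linear f by fact
  define P where "P B \<longleftrightarrow> pairwise orthogonal B \<and> (\<forall>v\<in>B. norm v = 1 \<and> (\<exists>c. f v = c *\<^sub>R v))" for B
  have indep: "independent B" if "P B" for B
    using that by (intro pairwise_orthogonal_independent) (auto simp: P_def)
  have "P {}" by (simp add: P_def)
  moreover have "\<forall>B. P B \<longrightarrow> card B < Suc DIM('a)"
    using independent_bound indep by (metis less_Suc_eq_le)
  ultimately obtain B where B: "P B" and max: "\<And>B'. P B' \<Longrightarrow> card B' \<le> card B"
    using ex_has_greatest_nat[of P "{}" card] by blast
  have "finite B" using indep[OF B] independent_bound by blast
  have "span B = UNIV"
  proof (rule ccontr)
    define S where "S = {x. \<forall>v\<in>B. orthogonal x v}"
    assume "span B \<noteq> UNIV"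
    then obtain x where "x \<noteq> 0" "\<And>y. y \<in> span B \<Longrightarrow> orthogonal x y"
      using orthogonal_to_subspace_exists_gen[of B UNIV] by (auto simp: psubset_eq)
    then have "S \<noteq> {0}" by (auto simp: S_def intro: span_base)
    moreover have "subspace S" by (auto simp: S_def subspace_def orthogonal_clauses)
    moreover have "f ` S \<subseteq> S"
    proof
      fix y assume "y \<in> f ` S"
      then obtain x where x: "x \<in> S" "y = f x" by blast
      have "orthogonal y v" if v: "v \<in> B" for v
      proof -
        obtain c where "f v = c *\<^sub>R v" using B v unfolding P_def by blast
        then show ?thesis using x v by (simp add: S_def orthogonal_def sa)
      qed
      then show "y \<in> S" by (simp add: S_def)
    qed
    ultimately obtain v c where v: "v \<in> S" "norm v = 1" "f v = c *\<^sub>R v"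
      using self_adjoint_has_eigenvector[OF lin sa, of S] by metis
    have "v \<notin> B" using v by (auto simp: S_def orthogonal_self)
    moreover have "P (insert v B)"
      using B v by (auto simp: P_def S_def pairwise_insert orthogonal_commute)
    ultimately show False using max[of "insert v B"] \<open>finite B\<close> by simp
  qed
  then show thesis using that[of B] B indep[OF B] unfolding P_def by blast
qed

text \<open>The eigenbasis, indexed by the nodes, forms the columns of an orthogonal matrix
  \<open>P\<close>. Parseval's identity says that its transpose is an isometry, and the determinant
  follows from similarity to a diagonal matrix.\<close>

lemma symmetric_matrix_diagonalizable:
  fixes M :: "real^'n^'n"
  assumes "transpose M = M"
  obtains v :: "'n \<Rightarrow> real^'n" and \<mu> :: "'n \<Rightarrow> real"
  where "\<And>i. M *v v i = \<mu> i *\<^sub>R v i" "\<And>i j. v i \<bullet> v j = (if i = j then 1 else 0)"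
    "\<And>x. (norm x)\<^sup>2 = (\<Sum>i\<in>UNIV. (v i \<bullet> x)\<^sup>2)"
    "\<And>x. det (mat x - M) = (\<Prod>i\<in>UNIV. (x - \<mu> i))"
proof -
  have sa: "(M *v x) \<bullet> y = x \<bullet> (M *v y)" for x y
    by (metis assms dot_lmul_matrix vector_transpose_matrix)
  obtain B where B: "pairwise orthogonal B" "\<And>v. v \<in> B \<Longrightarrow> norm v = 1"
    "\<And>v. v \<in> B \<Longrightarrow> \<exists>c. M *v v = c *\<^sub>R v" "independent B" "span B = UNIV"
    using self_adjoint_eigenbasis[of "(*v) M"] sa by auto
  have "card B = CARD('n)" using dim_eq_card[of B UNIV] B(4,5) by (simp add: span_UNIV)
  moreover have fin: "finite B" using B(4) independent_bound by blast
  ultimately obtain v where v: "bij_betw v (UNIV :: 'n set) B"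
    using finite_same_card_bij[of "UNIV :: 'n set" B] by auto
  have vB: "v i \<in> B" for i using v by (auto simp: bij_betw_def)
  obtain \<mu> where \<mu>: "\<And>i. M *v v i = \<mu> i *\<^sub>R v i" using B(3)[OF vB] by metis
  have orth: "v i \<bullet> v j = (if i = j then 1 else 0)" for i j
  proof (cases "i = j")
    case False
    then have "v i \<noteq> v j" using v by (auto simp: bij_betw_def inj_on_def)
    then show ?thesis using B(1) vB False by (auto simp: pairwise_def orthogonal_def)
  qed (use B(2)[OF vB] in \<open>simp add: dot_square_norm\<close>)
  define P where "P = (\<chi> i j. v j $ i)"
  have col: "column j P = v j" for j by (simp add: column_def P_def vec_eq_iff)
  have P: "orthogonal_matrix P"
    unfolding orthogonal_matrix_orthonormal_columns col
    using orth by (auto simp: orthogonal_def norm_eq_1)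
  have "(norm x)\<^sup>2 = (\<Sum>i\<in>UNIV. (v i \<bullet> x)\<^sup>2)" for x
  proof -
    have "orthogonal_transformation ((*v) (transpose P))"
      using P by (simp add: orthogonal_transformation_matrix)
    then have "norm (transpose P *v x) = norm x" by (simp add: orthogonal_transformation)
    moreover have "(transpose P *v x) $ i = v i \<bullet> x" for i
      by (simp add: matrix_vector_mult_def transpose_def P_def inner_vec_def)
    ultimately show ?thesis by (simp add: norm_vec_def L2_set_def sum_nonneg flip: real_sqrt_power)
  qed
  moreover have "det (mat x - M) = (\<Prod>i\<in>UNIV. (x - \<mu> i))" for x
  proof -
    define D where "D = (\<chi> i j. if i = j then x - \<mu> j else (0 :: real))"
    have "(mat x - M) ** P = P ** D"
    proof -
      have "column j ((mat x - M) ** P) = column j (P ** D)" for j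
      proof -
        have "column j ((mat x - M) ** P) = (mat x - M) *v v j"
          by (simp add: col[symmetric] column_def matrix_matrix_mult_def matrix_vector_mult_def vec_eq_iff)
        also have "\<dots> = (x - \<mu> j) *\<^sub>R v j"
          by (simp add: matrix_vector_mult_diff_rdistrib \<mu> scaleR_left_diff_distrib)
            (simp add: vec_eq_iff matrix_vector_mult_def mat_def if_distrib[where f = "\<lambda>x. x * _"] cong: if_cong)
        also have "\<dots> = column j (P ** D)"
          by (simp add: column_def matrix_matrix_mult_def D_def P_def vec_eq_iff if_distrib[where f = "\<lambda>x. _ * x"] cong: if_cong)
        finally show ?thesis .
      qed
      then show ?thesis by (simp add: vec_eq_iff column_def)
    qed
    then have "det (mat x - M) * det P = det P * det D" by (metis det_mul)
    moreover have "det P \<noteq> 0" using P det_orthogonal_matrix by fastforce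
    moreover have "det D = (\<Prod>i\<in>UNIV. (x - \<mu> i))" by (subst det_diagonal) (auto simp: D_def)
    ultimately show ?thesis by simp
  qed
  ultimately show thesis using that \<mu> orth by blast
qed

text \<open>Equal polynomials have equal root multisets. This moves sums over the spectrum from the
  node-indexed \<mu> to the given list \<open>lam\<close> without choosing a bijection.\<close>

lemma prod_linear_factors_eq_imp_sum_eq:
  fixes f :: "'a \<Rightarrow> real" and g :: "'b \<Rightarrow> real" and F :: "real \<Rightarrow> 'c::comm_monoid_add"
  assumes "finite A" "finite B" and eq: "\<And>x. (\<Prod>i\<in>A. (x - f i)) = (\<Prod>j\<in>B. (x - g j))"
  shows "(\<Sum>i\<in>A. F (f i)) = (\<Sum>j\<in>B. F (g j))"
proof -
  have "poly (\<Prod>i\<in>A. [:- f i, 1:]) = poly (\<Prod>j\<in>B. [:- g j, 1:])"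
    using eq by (auto simp: poly_prod fun_eq_iff)
  then have "proots (\<Prod>i\<in>A. [:- f i, 1:]) = proots (\<Prod>j\<in>B. [:- g j, 1:])"
    by (simp only: poly_eq_poly_eq_iff)
  then have "(\<Sum>i\<in>A. {#f i#}) = (\<Sum>j\<in>B. {#g j#})"
    by (simp add: proots_prod)
  then have "image_mset f (mset_set A) = image_mset g (mset_set B)"
    by (simp add: sum_unfold_sum_mset)
  then have "image_mset F (image_mset f (mset_set A)) = image_mset F (image_mset g (mset_set B))"
    by simp
  then show ?thesis by (simp add: sum_unfold_sum_mset multiset.map_comp o_def)
qed


section \<open>The matrix exponential\<close>

lemma bounded_linear_matrix_mult_left: "bounded_linear ((**) (A :: real^'n^'m) :: real^'k^'n \<Rightarrow> _)"
  unfolding linear_conv_bounded_linear[symmetric]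
  by (intro linearI) (simp_all add: matrix_add_ldistrib matrix_scalar_ac flip: scalar_matrix_assoc)

lemma bounded_linear_matrix_vector_mult_left: "bounded_linear (\<lambda>M :: real^'n^'m. M *v x)"
  unfolding linear_conv_bounded_linear[symmetric]
  by (intro linearI) (simp_all add: matrix_vector_mult_add_rdistrib scaleR_matrix_vector_assoc)

lemma bounded_linear_transpose: "bounded_linear (transpose :: real^'n^'m \<Rightarrow> _)"
  unfolding linear_conv_bounded_linear[symmetric]
  by (intro linearI) (simp_all add: transpose_def vec_eq_iff)

text \<open>An operator bound \<open>K\<close> for multiplication by \<open>A\<close> dominates the
  series by the exponential series of \<open>K\<close>.\<close>

lemma mexp_sums: "(\<lambda>k. (1 / fact k) *\<^sub>R ((**) A ^^ k) (mat 1)) sums mexp (A :: real^'n^'n)"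
proof -
  obtain K where "K > 0" and K: "\<And>X. norm (A ** (X :: real^'n^'n)) \<le> norm X * K"
    using bounded_linear.pos_bounded[OF bounded_linear_matrix_mult_left[of A]] by blast
  have bound: "norm (((**) A ^^ k) (mat 1)) \<le> norm (mat 1 :: real^'n^'n) * K ^ k" for k
  proof (induction k)
    case (Suc k)
    have "norm (((**) A ^^ Suc k) (mat 1)) \<le> norm (((**) A ^^ k) (mat 1)) * K" using K by simp
    also have "\<dots> \<le> norm (mat 1 :: real^'n^'n) * K ^ k * K" using Suc \<open>K > 0\<close> by simp
    finally show ?case by (simp add: mult_ac)
  qed simp
  have "summable (\<lambda>k. norm (mat 1 :: real^'n^'n) * (inverse (fact k) * K ^ k))"
    by (intro summable_mult summable_exp)
  then have "summable (\<lambda>k. (1 / fact k) *\<^sub>R ((**) A ^^ k) (mat 1))"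
    by (rule summable_comparison_test')
      (use bound in \<open>simp add: divide_simps mult_ac\<close>)
  then show ?thesis unfolding mexp_def by (rule summable_sums)
qed

lemma matrix_power_scaleR:
  fixes A :: "real^'n^'n"
  shows "((**) (t *\<^sub>R A) ^^ k) X = t ^ k *\<^sub>R ((**) A ^^ k) X"
  by (induction k) (simp_all add: matrix_scalar_ac flip: scalar_matrix_assoc)

text \<open>Transposition reverses products, which is harmless because powers of \<open>A\<close>
  commute with \<open>A\<close>.\<close>

lemma mexp_transpose: "mexp (transpose A) = transpose (mexp (A :: real^'n^'n))"
proof -
  have comm: "((**) A ^^ k) (mat 1) ** A = A ** ((**) A ^^ k) (mat 1)" for A :: "real^'n^'n" and k
    by (induction k) (simp_all flip: matrix_mul_assoc)
  have pow: "transpose (((**) A ^^ k) (mat 1)) = ((**) (transpose A) ^^ k) (mat 1)" for k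
    by (induction k) (simp_all add: matrix_transpose_mul comm)
  have "(\<lambda>k. transpose ((1 / fact k) *\<^sub>R ((**) A ^^ k) (mat 1))) sums transpose (mexp A)"
    by (rule bounded_linear.sums[OF bounded_linear_transpose mexp_sums])
  then have "(\<lambda>k. (1 / fact k) *\<^sub>R ((**) (transpose A) ^^ k) (mat 1)) sums transpose (mexp A)"
    by (simp add: linear_cmul[OF bounded_linear.linear[OF bounded_linear_transpose]] pow)
  then show ?thesis using mexp_sums sums_unique2 by blast
qed

text \<open>Each coordinate is an everywhere convergent real power series in \<open>t\<close>;
  termwise differentiation shifts its coefficients, which amounts to applying
  \<open>A\<close>.\<close>

lemma mexp_flow:
  fixes A :: "real^'n^'n"
  shows "((\<lambda>t. (mexp (t *\<^sub>R A) *v x) $ i) has_real_derivative (A *v (mexp (t *\<^sub>R A) *v x)) $ i) (at t)"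
    and "mexp (0 *\<^sub>R A) *v x = x"
proof -
  define p where "p k = ((**) A ^^ k) (mat 1) *v x" for k
  have bl: "bounded_linear (\<lambda>M :: real^'n^'n. (M *v x) $ i)" for i
    by (rule bounded_linear_compose[OF bounded_linear_vec_nth bounded_linear_matrix_vector_mult_left])
  have bl': "bounded_linear (\<lambda>M :: real^'n^'n. (A *v (M *v x)) $ i)" for i
    by (rule bounded_linear_compose[OF bounded_linear_vec_nth bounded_linear_compose
          [OF matrix_vector_mul_bounded_linear bounded_linear_matrix_vector_mult_left]])
  have sums: "(\<lambda>k. p k $ i / fact k * t ^ k) sums (mexp (t *\<^sub>R A) *v x) $ i" for t i
    using bounded_linear.sums[OF bl mexp_sums, of "t *\<^sub>R A" i]
    by (simp add: matrix_power_scaleR p_def scaleR_matrix_vector_assoc[symmetric] field_simps)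
  have sums': "(\<lambda>k. p (Suc k) $ i / fact k * t ^ k) sums (A *v (mexp (t *\<^sub>R A) *v x)) $ i" for t
    using bounded_linear.sums[OF bl' mexp_sums, of "t *\<^sub>R A" i]
    by (simp add: matrix_power_scaleR p_def scaleR_matrix_vector_assoc[symmetric]
        matrix_vector_mul_assoc[symmetric] matrix_vector_mult_scaleR field_simps)
  have diffs: "diffs (\<lambda>k. p k $ i / fact k) = (\<lambda>k. p (Suc k) $ i / fact k)"
    by (simp add: diffs_def fun_eq_iff del: of_nat_Suc)
  have eq: "(\<lambda>t. (mexp (t *\<^sub>R A) *v x) $ i) = (\<lambda>t. \<Sum>k. p k $ i / fact k * t ^ k)"
    using sums sums_unique by blast
  have "((\<lambda>t. \<Sum>k. p k $ i / fact k * t ^ k) has_field_derivative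
      (\<Sum>k. diffs (\<lambda>k. p k $ i / fact k) k * t ^ k)) (at t)"
    by (rule termdiffs_strong_converges_everywhere) (use sums in \<open>auto simp: sums_iff\<close>)
  then show "((\<lambda>t. (mexp (t *\<^sub>R A) *v x) $ i) has_real_derivative (A *v (mexp (t *\<^sub>R A) *v x)) $ i) (at t)"
    unfolding eq diffs using sums_unique[OF sums'] by simp
  have "(mexp (0 *\<^sub>R A) *v x) $ j = p 0 $ j / fact 0" for j
    using sums_unique2[OF sums[where t = 0 and i = j] powser_sums_zero] by simp
  then show "mexp (0 *\<^sub>R A) *v x = x" by (simp add: vec_eq_iff p_def)
qed

text \<open>The trace is a squared Frobenius norm, taken column by column: the H2 norm is the total
  energy of the responses to unit impulses in the separate inputs.\<close>

lemma h2_integrand_eq: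
  fixes A :: "real^'s^'s" and B :: "real^'p^'s" and C :: "real^'s^'q"
  shows "trace (transpose B ** mexp (t *\<^sub>R transpose A) ** transpose C ** C ** mexp (t *\<^sub>R A) ** B)
    = (\<Sum>j\<in>UNIV. (norm (C *v (mexp (t *\<^sub>R A) *v column j B)))\<^sup>2)"
proof -
  define M where "M = C ** mexp (t *\<^sub>R A) ** B"
  have "t *\<^sub>R transpose A = transpose (t *\<^sub>R A)" by (simp add: transpose_def vec_eq_iff)
  then have "transpose B ** mexp (t *\<^sub>R transpose A) ** transpose C ** C ** mexp (t *\<^sub>R A) ** B
      = transpose M ** M"
    by (simp add: M_def mexp_transpose matrix_transpose_mul matrix_mul_assoc)
  moreover have "trace (transpose M ** M) = (\<Sum>j\<in>UNIV. (norm (column j M))\<^sup>2)"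
    by (simp add: trace_def matrix_mult_transpose_dot_column power2_norm_eq_inner)
  moreover have "column j M = C *v (mexp (t *\<^sub>R A) *v column j B)" for j
    by (simp add: M_def matrix_vector_mul_assoc)
      (simp add: column_def matrix_matrix_mult_def matrix_vector_mult_def vec_eq_iff)
  ultimately show ?thesis by simp
qed

section \<open>Laplacians and modal coordinates\<close>

lemma laplacian_symmetric:
  assumes "connected_weighted_graph E w"
  shows "transpose (laplacian E w) = laplacian E w"
  using assms
  by (auto simp: connected_weighted_graph_def laplacian_def transpose_def vec_eq_iff sym_def)

text \<open>Twice the quadratic form is the Dirichlet sum of the weighted squares of
  \<open>x $ i - x $ j\<close>.\<close>

lemma laplacian_nonneg:
  fixes x :: "real^'n"
  assumes "connected_weighted_graph E w"
  shows "x \<bullet> (laplacian E w *v x) \<ge> 0"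
proof -
  \<comment> \<open>Extending the weights by zero makes symmetry and nonnegativity hold for all
    pairs, although \<open>w\<close> is arbitrary off \<open>E\<close>.\<close>
  define W where "W i j = (if (i, j) \<in> E then w i j else 0)" for i j
  have sym: "W i j = W j i" and nonneg: "W i j \<ge> 0" and diag: "W i i = 0" for i j
    using assms by (auto simp: W_def connected_weighted_graph_def sym_def irrefl_def less_imp_le)
  have "(\<Sum>k\<in>E `` {i}. w i k) = (\<Sum>k\<in>UNIV. W i k)" for i
    unfolding W_def by (simp add: sum.If_cases Image_singleton Collect_conj_eq)
  then have entry: "laplacian E w $ i $ j = (if i = j then (\<Sum>k\<in>UNIV. W i k) else 0) - W i j" for i j
    using diag[of j] by (auto simp: laplacian_def W_def split: if_splits)
  have "x \<bullet> (laplacian E w *v x) = (\<Sum>i\<in>UNIV. \<Sum>j\<in>UNIV. x $ i * (laplacian E w $ i $ j * x $ j))"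
    by (simp add: inner_vec_def matrix_vector_mult_def sum_distrib_left)
  also have "\<dots> = (\<Sum>i\<in>UNIV. \<Sum>j\<in>UNIV. W i j * (x $ i)\<^sup>2) - (\<Sum>i\<in>UNIV. \<Sum>j\<in>UNIV. W i j * (x $ i * x $ j))"
  proof -
    have "(\<Sum>j\<in>UNIV. x $ i * (laplacian E w $ i $ j * x $ j))
      = (\<Sum>j\<in>UNIV. (if i = j then (\<Sum>k\<in>UNIV. W i k) * (x $ i)\<^sup>2 else 0) - W i j * (x $ i * x $ j))" for i
      by (rule sum.cong) (auto simp: entry algebra_simps power2_eq_square)
    then show ?thesis by (simp add: sum_subtractf sum_distrib_right)
  qed
  finally have form: "x \<bullet> (laplacian E w *v x) = \<dots>" .
  have "(\<Sum>i\<in>UNIV. \<Sum>j\<in>UNIV. W i j * (x $ j)\<^sup>2) = (\<Sum>i\<in>UNIV. \<Sum>j\<in>UNIV. W i j * (x $ i)\<^sup>2)"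
    by (subst sum.swap) (simp add: sym)
  then have "2 * (x \<bullet> (laplacian E w *v x)) = (\<Sum>i\<in>UNIV. \<Sum>j\<in>UNIV. W i j * (x $ i)\<^sup>2)
     + (\<Sum>i\<in>UNIV. \<Sum>j\<in>UNIV. W i j * (x $ j)\<^sup>2) - 2 * (\<Sum>i\<in>UNIV. \<Sum>j\<in>UNIV. W i j * (x $ i * x $ j))"
    by (simp add: form)
  also have "\<dots> = (\<Sum>i\<in>UNIV. \<Sum>j\<in>UNIV. W i j * (x $ i - x $ j)\<^sup>2)"
    by (simp add: power2_diff ring_distribs sum.distrib sum_subtractf sum_distrib_left mult_ac)
  also have "\<dots> \<ge> 0" by (intro sum_nonneg mult_nonneg_nonneg nonneg) auto
  finally show ?thesis by simp
qed


section \<open>Reduction of the closed-loop system to scalar modes\<close>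

definition state_block :: "dpiac_block \<Rightarrow> real^(dpiac_block \<times> 'n) \<Rightarrow> real^'n" where
  "state_block b x = (\<chi> i. x $ (b, i))"

lemma dpiac_state_blocks:
  "dpiac_state (state_block Theta x) (state_block Omega x) (state_block Eta x) (state_block Xi x) = x"
proof -
  have "dpiac_state (state_block Theta x) (state_block Omega x) (state_block Eta x) (state_block Xi x) $ (b, i)
      = x $ (b, i)" for b i
    by (cases b) (simp_all add: dpiac_state_def state_block_def)
  then show ?thesis by (auto simp: vec_eq_iff)
qed

lemma state_block_dpiac_state:
  "state_block Theta (dpiac_state \<theta> \<omega> \<eta> \<xi>) = \<theta>" "state_block Omega (dpiac_state \<theta> \<omega> \<eta> \<xi>) = \<omega>"
  "state_block Eta (dpiac_state \<theta> \<omega> \<eta> \<xi>) = \<eta>" "state_block Xi (dpiac_state \<theta> \<omega> \<eta> \<xi>) = \<xi>"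
  by (simp_all add: state_block_def dpiac_state_def vec_eq_iff)

lemma dpiac_A_mult:
  "dpiac_A m d k1 k3 L *v x = dpiac_state (state_block Omega x)
      ((1 / m) *\<^sub>R (- (L *v state_block Theta x) - d *\<^sub>R state_block Omega x + (4 * k1) *\<^sub>R state_block Xi x))
      (d *\<^sub>R state_block Omega x + (4 * k1 * k3) *\<^sub>R (L *v state_block Xi x))
      (- (k1 * m) *\<^sub>R state_block Omega x - k1 *\<^sub>R state_block Eta x - (4 * k1) *\<^sub>R state_block Xi x)"
  using dpiac_state_equation[of m d k1 k3 L "state_block Theta x" "state_block Omega x"
      "state_block Eta x" "state_block Xi x" 0 0]
  by (simp add: dpiac_state_blocks)

lemma dpiac_output_mult: "dpiac_output b M *v x = M *v state_block b x"
  using dpiac_output_equation[of b M "state_block Theta x" "state_block Omega x"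
      "state_block Eta x" "state_block Xi x"]
  by (cases b) (simp_all add: dpiac_state_blocks)

definition impulse_response ::
    "real \<Rightarrow> real \<Rightarrow> real \<Rightarrow> real \<Rightarrow> real^'n^'n \<Rightarrow> 'n \<Rightarrow> real \<Rightarrow> real^(dpiac_block \<times> 'n)" where
  "impulse_response m d k1 k3 L j t =
     mexp (t *\<^sub>R dpiac_A m d k1 k3 L) *v column j (dpiac_input m (mat 1))"

text \<open>Taking the inner product of each block with an eigenvector \<open>v\<close> turns
  \<open>L\<close> into the scalar \<open>l\<close>. The impulse at node \<open>j\<close> becomes an
  initial frequency \<open>v $ j / m\<close>.\<close>

lemma impulse_response_energy:
  fixes L :: "real^'n^'n"
  assumes pos: "m > 0" "d > 0" "k1 > 0" "k3 > 0" and l: "l \<ge> 0" and v: "\<And>x. v \<bullet> (L *v x) = l * (v \<bullet> x)"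
  shows "((\<lambda>t. (v \<bullet> state_block Omega (impulse_response m d k1 k3 L j t))\<^sup>2) has_integral
      (v $ j)\<^sup>2 * (1 / (2 * m) * (dpiac_b1 m d k1 k3 l / dpiac_e m d k1 k3 l))) {0..}"
    and "((\<lambda>t. (4 * k1 * (v \<bullet> state_block Xi (impulse_response m d k1 k3 L j t)))\<^sup>2) has_integral
      (v $ j)\<^sup>2 * (dpiac_b2 m d k1 k3 l / dpiac_e m d k1 k3 l)) {0..}"
proof -
  let ?x = "impulse_response m d k1 k3 L j" and ?A = "dpiac_A m d k1 k3 L"
  define z where "z b t = v \<bullet> state_block b (?x t)" for b t
  have deriv: "(z b has_real_derivative v \<bullet> state_block b (?A *v ?x t)) (at t)" for b t
  proof -
    have "((\<lambda>t. ?x t $ p) has_real_derivative (?A *v ?x t) $ p) (at t)" for p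
      unfolding impulse_response_def by (rule mexp_flow)
    then show ?thesis
      unfolding z_def[abs_def] state_block_def inner_vec_def
      by (auto intro!: DERIV_sum DERIV_cmult)
  qed
  have init: "state_block b (?x 0) = (if b = Omega then axis j (1 / m) else 0)" for b
    unfolding impulse_response_def mexp_flow(2)
    by (simp add: state_block_def column_def dpiac_input_def axis_def mat_def vec_eq_iff)
  have 0: "z Theta 0 = 0" "z Omega 0 = v $ j / m" "z Eta 0 = 0" "z Xi 0 = 0"
    unfolding z_def init by (simp_all add: inner_axis)
  have \<theta>: "(z Theta has_real_derivative z Omega t) (at t)" for t
    using deriv[of Theta t] by (simp add: dpiac_A_mult state_block_dpiac_state z_def)
  have \<omega>: "(z Omega has_real_derivative (- l * z Theta t - d * z Omega t + 4 * k1 * z Xi t) / m) (at t)" for t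
    using deriv[of Omega t]
    by (simp add: dpiac_A_mult state_block_dpiac_state z_def inner_diff_right inner_add_right v)
  have \<eta>: "(z Eta has_real_derivative d * z Omega t + 4 * k1 * k3 * l * z Xi t) (at t)" for t
    using deriv[of Eta t]
    by (simp add: dpiac_A_mult state_block_dpiac_state z_def inner_add_right v mult.assoc)
  have \<xi>: "(z Xi has_real_derivative - k1 * m * z Omega t - k1 * z Eta t - 4 * k1 * z Xi t) (at t)" for t
    using deriv[of Xi t]
    by (simp add: dpiac_A_mult state_block_dpiac_state z_def inner_diff_right)
  from dpiac_mode_energy[OF pos l \<theta> \<omega> \<eta> \<xi> 0]
  show "((\<lambda>t. (v \<bullet> state_block Omega (?x t))\<^sup>2) has_integral
      (v $ j)\<^sup>2 * (1 / (2 * m) * (dpiac_b1 m d k1 k3 l / dpiac_e m d k1 k3 l))) {0..}"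
    "((\<lambda>t. (4 * k1 * (v \<bullet> state_block Xi (?x t)))\<^sup>2) has_integral
      (v $ j)\<^sup>2 * (dpiac_b2 m d k1 k3 l / dpiac_e m d k1 k3 l)) {0..}"
    by (simp_all only: z_def)
qed

text \<open>Parseval splits each impulse energy into modes. Summed over all impulses, the weights of
  mode \<open>i\<close> add up to the squared norm of \<open>v i\<close>, which is 1, so the mode
  contributes exactly \<open>F i\<close>.\<close>

lemma dpiac_squared_h2_norm:
  fixes L M :: "real^'n^'n" and v :: "'n \<Rightarrow> real^'n" and g F :: "'n \<Rightarrow> real"
  assumes orth: "\<And>i. norm (v i) = 1" and parseval: "\<And>x. (norm x)\<^sup>2 = (\<Sum>i\<in>UNIV. (v i \<bullet> x)\<^sup>2)"
    and M: "\<And>i x. v i \<bullet> (M *v x) = g i * (v i \<bullet> x)"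
    and F: "\<And>i j. ((\<lambda>t. (g i * (v i \<bullet> state_block b (impulse_response m d k1 k3 L j t)))\<^sup>2)
      has_integral (v i $ j)\<^sup>2 * F i) {0..}"
  shows "has_squared_h2_norm (dpiac_A m d k1 k3 L) (dpiac_input m (mat 1)) (dpiac_output b M)
    (\<Sum>i\<in>UNIV. F i)"
proof -
  have "((\<lambda>t. \<Sum>j\<in>UNIV. \<Sum>i\<in>UNIV. (g i * (v i \<bullet> state_block b (impulse_response m d k1 k3 L j t)))\<^sup>2)
      has_integral (\<Sum>j\<in>UNIV. \<Sum>i\<in>UNIV. (v i $ j)\<^sup>2 * F i)) {0..}"
    by (intro has_integral_sum F finite)
  moreover have "(\<Sum>j\<in>UNIV. \<Sum>i\<in>UNIV. (v i $ j)\<^sup>2 * F i) = (\<Sum>i\<in>UNIV. F i)"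
  proof -
    have "(\<Sum>j\<in>UNIV. (v i $ j)\<^sup>2) = 1" for i
      using orth[of i] power2_norm_eq_inner[of "v i"] by (simp add: inner_vec_def power2_eq_square)
    then show ?thesis by (subst sum.swap) (simp flip: sum_distrib_right)
  qed
  ultimately show ?thesis
    unfolding has_squared_h2_norm_def h2_integrand_eq dpiac_output_mult impulse_response_def[symmetric]
      parseval M by simp
qed

section \<open>Summation over the Laplacian spectrum\<close>

theorem theorem4p6:
  fixes L :: "real^'n^'n" and E :: "('n \<times> 'n) set" and w :: "'n \<Rightarrow> 'n \<Rightarrow> real"
    and m d k1 k3 :: real and lam b1 b2 e :: "nat \<Rightarrow> real"
  assumes "m > 0" "d > 0" "k1 > 0" "k3 > 0"
    and "connected_weighted_graph E w"
    and "L = laplacian E w"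
    and "eigenvalues_with_mult L lam" and "lam 1 = 0"
    and "\<And>i. i \<in> {2..CARD('n)} \<Longrightarrow>
      b1 i = (lam i)\<^sup>2 * (4 * k1\<^sup>2 * k3 * m - 1)\<^sup>2 + 4 * d * m * k1^3
        + k1 * (d + 4 * k1 * m) * (4 * d * lam i * k1 * k3 + 5 * lam i + 4 * d * k1)"
    and "\<And>i. i \<in> {2..CARD('n)} \<Longrightarrow>
      b2 i = 2 * d * k1^3 * (d + 2 * k1 * m)\<^sup>2
        + 2 * lam i * k1^4 * m\<^sup>2 * (4 * k1 * k3 * d + 4)"
    and "\<And>i. i \<in> {2..CARD('n)} \<Longrightarrow>
      e i = d * (lam i)\<^sup>2 * (4 * k1\<^sup>2 * k3 * m - 1)\<^sup>2
        + 16 * d * lam i * k1^4 * k3 * m\<^sup>2 + d\<^sup>2 * lam i * k1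
        + 4 * k1 * (d + 2 * k1 * m)\<^sup>2 * (d * k1 + lam i + d * lam i * k1 * k3)"
  shows "has_squared_h2_norm (dpiac_A m d k1 k3 L) (dpiac_input m (mat 1))
           (dpiac_output Omega (mat 1))
           (1 / (2 * m) * (\<Sum>i=2..CARD('n). b1 i / e i)
             + (d + 5 * m * k1) / (2 * m * (2 * k1 * m + d)\<^sup>2))
       \<and> has_squared_h2_norm (dpiac_A m d k1 k3 L) (dpiac_input m (mat 1))
           (dpiac_output Xi (mat (4 * k1)))
           (k1 / 2 + (\<Sum>i=2..CARD('n). b2 i / e i))
       \<and> has_squared_h2_norm (dpiac_A m d k1 k3 L) (dpiac_input m (mat 1))
           (dpiac_output Xi ((4 * k1) *\<^sub>R L))
           (\<Sum>i=2..CARD('n). (lam i)\<^sup>2 * b2 i / e i)"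
proof -
  note pos = assms(1-4)
  have sym: "transpose L = L" using laplacian_symmetric assms(5,6) by blast
  obtain v :: "'n \<Rightarrow> real^'n" and \<mu> :: "'n \<Rightarrow> real"
    where v: "\<And>i. L *v v i = \<mu> i *\<^sub>R v i" and orth: "\<And>i j. v i \<bullet> v j = (if i = j then 1 else 0)"
      and parseval: "\<And>x. (norm x)\<^sup>2 = (\<Sum>i\<in>UNIV. (v i \<bullet> x)\<^sup>2)"
      and det: "\<And>x. det (mat x - L) = (\<Prod>i\<in>UNIV. (x - \<mu> i))"
    using symmetric_matrix_diagonalizable[OF sym] by blast
  have norm: "norm (v i) = 1" for i using orth[of i i] by (simp add: norm_eq_1)
  have vL: "v i \<bullet> (L *v x) = \<mu> i * (v i \<bullet> x)" for i x
  proof -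
    have "v i \<bullet> (L *v x) = (L *v v i) \<bullet> x" 
      using dot_lmul_matrix[of "v i" L x] vector_transpose_matrix[of "v i" L] by (simp add: sym)
    then show ?thesis by (simp add: v)
  qed
  have \<mu>: "\<mu> i \<ge> 0" for i
    using laplacian_nonneg[OF assms(5), of "v i"] by (simp add: assms(6)[symmetric] v orth)
  have vmat: "v i \<bullet> (mat c *v x) = c * (v i \<bullet> x)" for i c x
  proof -
    have "mat c *v x = c *\<^sub>R x" by (simp add: vec_eq_iff matrix_vector_mult_def sum_mat_mult)
    then show ?thesis by simp
  qed
  have "(\<Prod>i=1..CARD('n). (x - lam i)) = (\<Prod>i\<in>UNIV. (x - \<mu> i))" for x
    using assms(7) det by (simp add: eigenvalues_with_mult_def)
  then have "(\<Sum>i=1..CARD('n). F (lam i)) = (\<Sum>i\<in>UNIV. F (\<mu> i))" for F :: "real \<Rightarrow> real"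
    by (intro prod_linear_factors_eq_imp_sum_eq) auto
  \<comment> \<open>Since \<open>lam 1 = 0\<close>, the first summand is \<open>F 0\<close>, the
    source of the constant terms.\<close>
  then have spectrum: "(\<Sum>i\<in>UNIV. F (\<mu> i)) = F 0 + (\<Sum>i=2..CARD('n). F (lam i))" for F :: "real \<Rightarrow> real"
    using sum.atLeast_Suc_atMost[of 1 "CARD('n)" "\<lambda>i. F (lam i)"] assms(8)
    by (simp add: Suc_leI numeral_2_eq_2)
  have coeffs: "b1 i = dpiac_b1 m d k1 k3 (lam i)" "b2 i = dpiac_b2 m d k1 k3 (lam i)"
    "e i = dpiac_e m d k1 k3 (lam i)" if "i \<in> {2..CARD('n)}" for i
    using assms(9-11) that by (simp_all add: dpiac_b1_def dpiac_b2_def dpiac_e_def)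
  note energy = impulse_response_energy[OF pos \<mu> vL]
  have at_0: "1 / (2 * m) * (dpiac_b1 m d k1 k3 0 / dpiac_e m d k1 k3 0)
      = (d + 5 * m * k1) / (2 * m * (2 * k1 * m + d)\<^sup>2)"
    "dpiac_b2 m d k1 k3 0 / dpiac_e m d k1 k3 0 = k1 / 2"
  proof -
    have nz: "d + 2 * k1 * m \<noteq> 0" using pos by (metis add_pos_pos less_irrefl mult_pos_pos zero_less_numeral)
    have e: "dpiac_e m d k1 k3 0 = 4 * d * k1\<^sup>2 * (d + 2 * k1 * m)\<^sup>2"
      by (simp add: dpiac_e_def power2_eq_square)
    have b1: "dpiac_b1 m d k1 k3 0 = 4 * d * k1\<^sup>2 * (d + 5 * m * k1)"
      by (simp add: dpiac_b1_def power2_eq_square power3_eq_cube algebra_simps)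
    have b2: "dpiac_b2 m d k1 k3 0 = 4 * d * k1\<^sup>2 * (d + 2 * k1 * m)\<^sup>2 * (k1 / 2)"
      by (simp add: dpiac_b2_def power2_eq_square power3_eq_cube)
    show "1 / (2 * m) * (dpiac_b1 m d k1 k3 0 / dpiac_e m d k1 k3 0)
      = (d + 5 * m * k1) / (2 * m * (2 * k1 * m + d)\<^sup>2)"
      unfolding e b1 using pos by (simp add: add.commute)
    show "dpiac_b2 m d k1 k3 0 / dpiac_e m d k1 k3 0 = k1 / 2"
      unfolding e b2 using pos nz by simp
  qed
  show ?thesis
  proof (intro conjI)
    have "has_squared_h2_norm (dpiac_A m d k1 k3 L) (dpiac_input m (mat 1)) (dpiac_output Omega (mat 1))
        (\<Sum>i\<in>UNIV. 1 / (2 * m) * (dpiac_b1 m d k1 k3 (\<mu> i) / dpiac_e m d k1 k3 (\<mu> i)))"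
      using energy(1) by (intro dpiac_squared_h2_norm[OF norm parseval vmat]) simp
    moreover have "(\<Sum>i\<in>UNIV. 1 / (2 * m) * (dpiac_b1 m d k1 k3 (\<mu> i) / dpiac_e m d k1 k3 (\<mu> i)))
        = 1 / (2 * m) * (\<Sum>i=2..CARD('n). b1 i / e i) + (d + 5 * m * k1) / (2 * m * (2 * k1 * m + d)\<^sup>2)"
      unfolding spectrum[of "\<lambda>l. 1 / (2 * m) * (dpiac_b1 m d k1 k3 l / dpiac_e m d k1 k3 l)"] at_0
      by (simp add: coeffs sum_divide_distrib mult_ac)
    ultimately show "has_squared_h2_norm (dpiac_A m d k1 k3 L) (dpiac_input m (mat 1)) (dpiac_output Omega (mat 1))
        (1 / (2 * m) * (\<Sum>i=2..CARD('n). b1 i / e i) + (d + 5 * m * k1) / (2 * m * (2 * k1 * m + d)\<^sup>2))"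
      by (simp only:)
  next
    have "has_squared_h2_norm (dpiac_A m d k1 k3 L) (dpiac_input m (mat 1)) (dpiac_output Xi (mat (4 * k1)))
        (\<Sum>i\<in>UNIV. dpiac_b2 m d k1 k3 (\<mu> i) / dpiac_e m d k1 k3 (\<mu> i))"
      by (intro dpiac_squared_h2_norm[OF norm parseval vmat] energy(2))
    moreover have "(\<Sum>i\<in>UNIV. dpiac_b2 m d k1 k3 (\<mu> i) / dpiac_e m d k1 k3 (\<mu> i))
        = k1 / 2 + (\<Sum>i=2..CARD('n). b2 i / e i)"
      unfolding spectrum[of "\<lambda>l. dpiac_b2 m d k1 k3 l / dpiac_e m d k1 k3 l"] at_0 by (simp add: coeffs)
    ultimately show "has_squared_h2_norm (dpiac_A m d k1 k3 L) (dpiac_input m (mat 1)) (dpiac_output Xi (mat (4 * k1)))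
        (k1 / 2 + (\<Sum>i=2..CARD('n). b2 i / e i))"
      by (simp only:)
  next
    have "has_squared_h2_norm (dpiac_A m d k1 k3 L) (dpiac_input m (mat 1)) (dpiac_output Xi ((4 * k1) *\<^sub>R L))
        (\<Sum>i\<in>UNIV. (\<mu> i)\<^sup>2 * dpiac_b2 m d k1 k3 (\<mu> i) / dpiac_e m d k1 k3 (\<mu> i))"
    proof (rule dpiac_squared_h2_norm[OF norm parseval])
      show "v i \<bullet> (((4 * k1) *\<^sub>R L) *v x) = (4 * k1 * \<mu> i) * (v i \<bullet> x)" for i x
        by (simp add: vL flip: scaleR_matrix_vector_assoc)
      show "((\<lambda>t. (4 * k1 * \<mu> i * (v i \<bullet> state_block Xi (impulse_response m d k1 k3 L j t)))\<^sup>2) has_integral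
          (v i $ j)\<^sup>2 * ((\<mu> i)\<^sup>2 * dpiac_b2 m d k1 k3 (\<mu> i) / dpiac_e m d k1 k3 (\<mu> i))) {0..}" for i j
        using has_integral_mult_right[OF energy(2)[of i j], of "(\<mu> i)\<^sup>2"]
        by (simp add: power_mult_distrib mult_ac)
    qed
    moreover have "(\<Sum>i\<in>UNIV. (\<mu> i)\<^sup>2 * dpiac_b2 m d k1 k3 (\<mu> i) / dpiac_e m d k1 k3 (\<mu> i))
        = (\<Sum>i=2..CARD('n). (lam i)\<^sup>2 * b2 i / e i)"
      \<comment> \<open>The factor \<open>l\<^sup>2\<close> annihilates the zero mode, so no
        constant term appears here.\<close>
      unfolding spectrum[of "\<lambda>l. l\<^sup>2 * dpiac_b2 m d k1 k3 l / dpiac_e m d k1 k3 l"] by (simp add: coeffs)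
    ultimately show "has_squared_h2_norm (dpiac_A m d k1 k3 L) (dpiac_input m (mat 1)) (dpiac_output Xi ((4 * k1) *\<^sub>R L))
        (\<Sum>i=2..CARD('n). (lam i)\<^sup>2 * b2 i / e i)"
      by (simp only:)
  qed
qed

end
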